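(* There is an $\mathrm O(W_{\mathbb R})\times\mathbb R^\times$-equivariant stratified homeomorphism $$\mathfrak M_0(\mathbb R)\xrightarrow{\ \sim\ }\mathfrak M_0^{sym}(\mathbb C)$$ which restricts to real analytic $\mathrm O(W_{\mathbb R})$-equivariant isomorphisms between individual real and symmetric symplectic leaves. The homeomorphism induces a bijection $$\{\mathcal O_l(\mathbb R)\}_l\longleftrightarrow\{\mathcal O_l^{sym}(\mathbb C)\}_l$$ between real and symmetric leaves preserving the closure relation.
   Context: Let $Q=(Q_0,Q_1)$ be a quiver (vertices $Q_0$, arrows $Q_1$), with $o(h),i(h)$ the outgoing and incoming vertices of $h\in Q_1$. Let $\mathbf v,\mathbf w\in\mathbb Z_{\ge0}^{Q_0}$, $V=\bigoplus_k\mathbb C^{\mathbf v_k}$, $W=\bigoplus_k\mathbb C^{\mathbf w_k}$ with standard hermitian inner products, and $$\mathbf M=\bigoplus_{h\in Q_1}\big(\mathrm{Hom}(V_{o(h)},V_{i(h)})\oplus\mathrm{Hom}(V_{i(h)},V_{o(h)})\big)\oplus\bigoplus_{k\in Q_0}\big(\mathrm{Hom}(W_k,V_k)\oplus\mathrm{Hom}(V_k,W_k)\big),$$ with elements written $(X,Y,x,y)$, complex structure $I$ (multiplication by $\sqrt{-1}$), $J(X,Y,x,y)=(-Y^\dagger,X^\dagger,-y^\dagger,x^\dagger)$ ($\dagger$ = hermitian adjoint), $K=IJ$, and inner product induced by $(f,g)=\mathrm{tr}(fg^\dagger)$. The group $H=\mathrm{GL}(V)=\prod_k\mathrm{GL}(V_k)$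 and $G=\mathrm{GL}(W)=\prod_k\mathrm{GL}(W_k)$ act by $(g,g')(X,Y,x,y)=(gXg^{-1},gYg^{-1},gx(g')^{-1},g'yg^{-1})$; let $H_u=\mathrm U(V)=\prod_k\mathrm U(V_k)$. The moment maps for $\mathrm U(V)$ are $\mu_{\mathbb R}=\frac{\sqrt{-1}}2(XX^\dagger-Y^\dagger Y+xx^\dagger-y^\dagger y)$ and $\mu_{\mathbb C}=[X,Y]+xy$. The quiver variety is $\mathfrak M_0=(\mu_{\mathbb R}^{-1}(0)\cap\mu_{\mathbb C}^{-1}(0))/\mathrm U(V)\simeq\mu_{\mathbb C}^{-1}(0)/\!/\mathrm{GL}(V)$. It is stratified as $\bigsqcup_{(L)}\mathfrak M_{0,(L)}$, where $\mathfrak M_{0,(L)}$ consists of orbits through points whose stabilizer in $\mathrm U(V)$ is conjugate to $L$ (these strata are the symplectic leaves). For a quaternion $q$ of norm one, $\phi(q):\mathfrak M_0\to\mathfrak M_0$ is induced by multiplication by $q$ on $\mathbf M$ ($i,j,k$ acting by $I,J,K$); $\mathbb R^\times$ acts on $\mathfrak M_0$ through scaling on $\mathbf M$. Let $\eta:\mathfrak M_0\to\mathfrak M_0$ be the split conjugation, induced by entrywise complex conjugation $(X,Y,x,y)\mapsto(\overline X,\overline Y,\overline x,\overline y)$. Set $\alpha_0=\phi(i)\circ\eta$ and $\alpha_1=\phi(k)\circ\eta$ (involutions), $\mathfrak M_0(\mathbb R)=\mathfrak M_0^{\alpha_0}$, $\mathfrak M_0^{sym}(\mathbb C)=\mathfrak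 M_0^{\alpha_1}$, stratified by intersection with the strata $\mathfrak M_{0,(L)}$. The connected components $\mathcal O_l(\mathbb R)$ of the sets $\mathfrak M_{0,(L)}\cap\mathfrak M_0(\mathbb R)$ are the real symplectic leaves, and the connected components $\mathcal O_l^{sym}(\mathbb C)$ of the sets $\mathfrak M_{0,(L)}\cap\mathfrak M_0^{sym}(\mathbb C)$ are the symmetric symplectic leaves. $\mathrm O(W_{\mathbb R})=\prod_k\mathrm O_{\mathbf w_k}(\mathbb R)=\mathrm U(W)\cap\mathrm{GL}(W_{\mathbb R})$ acts via $\mathrm{GL}(W)$.
   Formalization: The real moment map is taken to be the actual U(V) moment map, with XX†−Y†Y replaced by XX†−X†X+YY†−Y†Y at the appropriate vertices; with the printed formula read literally the claim fails (one loop, v=1, w=0). *)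

theory Defs
  imports
    "HOL-Analysis.Analysis"
    "HOL-Algebra.Product_Groups"
    "Jordan_Normal_Form.Schur_Decomposition"
    "Graph_Theory.Digraph"
begin

section \<open>The representation space\<close>

text \<open>
  A quiver is a finite directed multigraph with loops allowed (locale \<^locale>\<open>fin_digraph\<close>):
  \<^const>\<open>tail\<close> is the outgoing vertex \<open>o\<close> and \<^const>\<open>head\<close> the incoming vertex \<open>i\<close> of an arrow.
  A point of \<open>M\<close> is an extensional family of matrices indexed by the direct summands:
  \<open>ArrX h\<close> is \<open>Hom(V\<^bsub>o(h)\<^esub>, V\<^bsub>i(h)\<^esub>)\<close>, \<open>ArrY h\<close> is \<open>Hom(V\<^bsub>i(h)\<^esub>, V\<^bsub>o(h)\<^esub>)\<close>,
  \<open>FrX k\<close> is \<open>Hom(W\<^sub>k, V\<^sub>k)\<close>, \<open>FrY k\<close> is \<open>Hom(V\<^sub>k, W\<^sub>k)\<close>.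
\<close>

datatype ('k, 'h) summand = ArrX 'h | ArrY 'h | FrX 'k | FrY 'k

type_synonym ('k, 'h) qrep = "('k, 'h) summand \<Rightarrow> complex mat"

definition summands :: "('k, 'h) pre_digraph \<Rightarrow> ('k, 'h) summand set" where
  "summands Q = ArrX ` arcs Q \<union> ArrY ` arcs Q \<union> FrX ` verts Q \<union> FrY ` verts Q"

fun cod_dim :: "('k, 'h) pre_digraph \<Rightarrow> ('k \<Rightarrow> nat) \<Rightarrow> ('k \<Rightarrow> nat) \<Rightarrow> ('k, 'h) summand \<Rightarrow> nat" where
  "cod_dim Q v w (ArrX h) = v (head Q h)"
| "cod_dim Q v w (ArrY h) = v (tail Q h)"
| "cod_dim Q v w (FrX k) = v k"
| "cod_dim Q v w (FrY k) = w k"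

fun dom_dim :: "('k, 'h) pre_digraph \<Rightarrow> ('k \<Rightarrow> nat) \<Rightarrow> ('k \<Rightarrow> nat) \<Rightarrow> ('k, 'h) summand \<Rightarrow> nat" where
  "dom_dim Q v w (ArrX h) = v (tail Q h)"
| "dom_dim Q v w (ArrY h) = v (head Q h)"
| "dom_dim Q v w (FrX k) = w k"
| "dom_dim Q v w (FrY k) = v k"

definition rep_space :: "('k, 'h) pre_digraph \<Rightarrow> ('k \<Rightarrow> nat) \<Rightarrow> ('k \<Rightarrow> nat) \<Rightarrow> ('k, 'h) qrep set" where
  "rep_space Q v w = (\<Pi>\<^sub>E s\<in>summands Q. carrier_mat (cod_dim Q v w s) (dom_dim Q v w s))"

definition cx_I :: "('k, 'h) pre_digraph \<Rightarrow> ('k, 'h) qrep \<Rightarrow> ('k, 'h) qrep" where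
  "cx_I Q m = (\<lambda>s\<in>summands Q. \<i> \<cdot>\<^sub>m m s)"

definition cx_J :: "('k, 'h) pre_digraph \<Rightarrow> ('k, 'h) qrep \<Rightarrow> ('k, 'h) qrep" where
  "cx_J Q m = (\<lambda>s\<in>summands Q. case s of
      ArrX h \<Rightarrow> - mat_adjoint (m (ArrY h))
    | ArrY h \<Rightarrow> mat_adjoint (m (ArrX h))
    | FrX k \<Rightarrow> - mat_adjoint (m (FrY k))
    | FrY k \<Rightarrow> mat_adjoint (m (FrX k)))"

definition cx_K :: "('k, 'h) pre_digraph \<Rightarrow> ('k, 'h) qrep \<Rightarrow> ('k, 'h) qrep" where
  "cx_K Q = cx_I Q \<circ> cx_J Q"

definition rep_conj :: "('k, 'h) pre_digraph \<Rightarrow> ('k, 'h) qrep \<Rightarrow> ('k, 'h) qrep" where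
  "rep_conj Q m = (\<lambda>s\<in>summands Q. map_mat cnj (m s))"

definition rep_scale :: "('k, 'h) pre_digraph \<Rightarrow> real \<Rightarrow> ('k, 'h) qrep \<Rightarrow> ('k, 'h) qrep" where
  "rep_scale Q t m = (\<lambda>s\<in>summands Q. complex_of_real t \<cdot>\<^sub>m m s)"

text \<open>Real coordinates (real and imaginary parts of all matrix entries); they carry the Euclidean
  topology and the real analytic structure of \<open>M\<close>.\<close>

definition coord_set ::
  "('k, 'h) pre_digraph \<Rightarrow> ('k \<Rightarrow> nat) \<Rightarrow> ('k \<Rightarrow> nat) \<Rightarrow> (('k, 'h) summand \<times> nat \<times> nat \<times> bool) set" where
  "coord_set Q v w =
    (SIGMA s:summands Q. {..<cod_dim Q v w s} \<times> {..<dom_dim Q v w s} \<times> UNIV)"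

definition coords ::
  "('k, 'h) pre_digraph \<Rightarrow> ('k \<Rightarrow> nat) \<Rightarrow> ('k \<Rightarrow> nat) \<Rightarrow> ('k, 'h) qrep
    \<Rightarrow> ('k, 'h) summand \<times> nat \<times> nat \<times> bool \<Rightarrow> real" where
  "coords Q v w m =
    (\<lambda>(s, i, j, b)\<in>coord_set Q v w. if b then Re (m s $$ (i, j)) else Im (m s $$ (i, j)))"

definition rep_top ::
  "('k, 'h) pre_digraph \<Rightarrow> ('k \<Rightarrow> nat) \<Rightarrow> ('k \<Rightarrow> nat) \<Rightarrow> ('k, 'h) qrep topology" where
  "rep_top Q v w = pullback_topology (rep_space Q v w) (coords Q v w)
     (product_topology (\<lambda>_. euclideanreal) (coord_set Q v w))"

section \<open>Groups and their actions\<close>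

definition GL_mat :: "nat \<Rightarrow> complex mat monoid" where
  "GL_mat n = units_of (ring_mat TYPE(complex) n ())"

definition U_mat :: "nat \<Rightarrow> complex mat monoid" where
  "U_mat n = (GL_mat n)\<lparr>carrier := {A \<in> carrier (GL_mat n). A * mat_adjoint A = 1\<^sub>m n}\<rparr>"

definition GL_group :: "('k, 'h) pre_digraph \<Rightarrow> ('k \<Rightarrow> nat) \<Rightarrow> ('k \<Rightarrow> complex mat) monoid" where
  "GL_group Q d = product_group (verts Q) (\<lambda>k. GL_mat (d k))"

definition U_group :: "('k, 'h) pre_digraph \<Rightarrow> ('k \<Rightarrow> nat) \<Rightarrow> ('k \<Rightarrow> complex mat) monoid" where
  "U_group Q d = product_group (verts Q) (\<lambda>k. U_mat (d k))"

definition GL_real :: "('k, 'h) pre_digraph \<Rightarrow> ('k \<Rightarrow> nat) \<Rightarrow> ('k \<Rightarrow> complex mat) set" where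
  "GL_real Q d = {g \<in> carrier (GL_group Q d).
     \<forall>k\<in>verts Q. \<forall>i<d k. \<forall>j<d k. g k $$ (i, j) \<in> \<real>}"

definition O_real :: "('k, 'h) pre_digraph \<Rightarrow> ('k \<Rightarrow> nat) \<Rightarrow> ('k \<Rightarrow> complex mat) set" where
  "O_real Q d = carrier (U_group Q d) \<inter> GL_real Q d"

definition rep_act ::
  "('k, 'h) pre_digraph \<Rightarrow> ('k \<Rightarrow> nat) \<Rightarrow> ('k \<Rightarrow> nat)
    \<Rightarrow> ('k \<Rightarrow> complex mat) \<Rightarrow> ('k \<Rightarrow> complex mat) \<Rightarrow> ('k, 'h) qrep \<Rightarrow> ('k, 'h) qrep" where
  "rep_act Q v w g g' m = (\<lambda>s\<in>summands Q. case s of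
      ArrX h \<Rightarrow> g (head Q h) * m s * inv\<^bsub>GL_mat (v (tail Q h))\<^esub> g (tail Q h)
    | ArrY h \<Rightarrow> g (tail Q h) * m s * inv\<^bsub>GL_mat (v (head Q h))\<^esub> g (head Q h)
    | FrX k \<Rightarrow> g k * m s * inv\<^bsub>GL_mat (w k)\<^esub> g' k
    | FrY k \<Rightarrow> g' k * m s * inv\<^bsub>GL_mat (v k)\<^esub> g k)"

definition V_orbit ::
  "('k, 'h) pre_digraph \<Rightarrow> ('k \<Rightarrow> nat) \<Rightarrow> ('k \<Rightarrow> nat) \<Rightarrow> ('k, 'h) qrep \<Rightarrow> ('k, 'h) qrep set" where
  "V_orbit Q v w m = (\<lambda>g. rep_act Q v w g \<one>\<^bsub>GL_group Q w\<^esub> m) ` carrier (U_group Q v)"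

definition V_stab ::
  "('k, 'h) pre_digraph \<Rightarrow> ('k \<Rightarrow> nat) \<Rightarrow> ('k \<Rightarrow> nat) \<Rightarrow> ('k, 'h) qrep \<Rightarrow> ('k \<Rightarrow> complex mat) set" where
  "V_stab Q v w m = {g \<in> carrier (U_group Q v). rep_act Q v w g \<one>\<^bsub>GL_group Q w\<^esub> m = m}"

section \<open>Moment maps and the quiver variety\<close>

definition msum :: "nat \<Rightarrow> 'h set \<Rightarrow> ('h \<Rightarrow> complex mat) \<Rightarrow> complex mat" where
  "msum n A f = mat n n (\<lambda>ij. \<Sum>h\<in>A. f h $$ ij)"

text \<open>
  The component at vertex \<open>k\<close> of the moment maps. In the complex one, \<open>[X,Y]\<close> contributes
  \<open>X\<^sub>h Y\<^sub>h\<close> at the incoming and \<open>- Y\<^sub>h X\<^sub>h\<close> at the outgoing vertex of \<open>h\<close>.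
  In the real one, the expression \<open>X X\<^sup>\<dagger> - Y\<^sup>\<dagger> Y\<close> is summed over the doubled quiver, where the
  reversed arrow of \<open>h\<close> carries the pair \<open>(Y\<^sub>h, X\<^sub>h)\<close> up to sign; this is what makes it the
  moment map of the unitary group (summing over the original arrows only would give a zero set
  that is not stable under \<open>J\<close>).
\<close>

definition mu_C ::
  "('k, 'h) pre_digraph \<Rightarrow> ('k \<Rightarrow> nat) \<Rightarrow> ('k, 'h) qrep \<Rightarrow> 'k \<Rightarrow> complex mat" where
  "mu_C Q v m = (\<lambda>k\<in>verts Q.
      msum (v k) {h \<in> arcs Q. head Q h = k} (\<lambda>h. m (ArrX h) * m (ArrY h))
    - msum (v k) {h \<in> arcs Q. tail Q h = k} (\<lambda>h. m (ArrY h) * m (ArrX h))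
    + m (FrX k) * m (FrY k))"

definition mu_R ::
  "('k, 'h) pre_digraph \<Rightarrow> ('k \<Rightarrow> nat) \<Rightarrow> ('k, 'h) qrep \<Rightarrow> 'k \<Rightarrow> complex mat" where
  "mu_R Q v m = (\<lambda>k\<in>verts Q. (\<i> / 2) \<cdot>\<^sub>m
     (msum (v k) {h \<in> arcs Q. head Q h = k}
        (\<lambda>h. m (ArrX h) * mat_adjoint (m (ArrX h)) - mat_adjoint (m (ArrY h)) * m (ArrY h))
    + msum (v k) {h \<in> arcs Q. tail Q h = k}
        (\<lambda>h. m (ArrY h) * mat_adjoint (m (ArrY h)) - mat_adjoint (m (ArrX h)) * m (ArrX h))
    + (m (FrX k) * mat_adjoint (m (FrX k)) - mat_adjoint (m (FrY k)) * m (FrY k))))"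

definition mu_zero :: "('k, 'h) pre_digraph \<Rightarrow> ('k \<Rightarrow> nat) \<Rightarrow> ('k \<Rightarrow> nat) \<Rightarrow> ('k, 'h) qrep set" where
  "mu_zero Q v w = {m \<in> rep_space Q v w.
     mu_R Q v m = (\<lambda>k\<in>verts Q. 0\<^sub>m (v k) (v k)) \<and> mu_C Q v m = (\<lambda>k\<in>verts Q. 0\<^sub>m (v k) (v k))}"

definition M0 :: "('k, 'h) pre_digraph \<Rightarrow> ('k \<Rightarrow> nat) \<Rightarrow> ('k \<Rightarrow> nat) \<Rightarrow> ('k, 'h) qrep set set" where
  "M0 Q v w = V_orbit Q v w ` mu_zero Q v w"

definition M0_top ::
  "('k, 'h) pre_digraph \<Rightarrow> ('k \<Rightarrow> nat) \<Rightarrow> ('k \<Rightarrow> nat) \<Rightarrow> ('k, 'h) qrep set topology" where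
  "M0_top Q v w = topology (\<lambda>U. U \<subseteq> M0 Q v w \<and>
     openin (subtopology (rep_top Q v w) (mu_zero Q v w)) {m \<in> mu_zero Q v w. V_orbit Q v w m \<in> U})"

lemma openin_M0_top:
  "openin (M0_top Q v w) U \<longleftrightarrow> U \<subseteq> M0 Q v w \<and>
     openin (subtopology (rep_top Q v w) (mu_zero Q v w)) {m \<in> mu_zero Q v w. V_orbit Q v w m \<in> U}"
proof -
  let ?T = "subtopology (rep_top Q v w) (mu_zero Q v w)"
  let ?P = "\<lambda>U. {m \<in> mu_zero Q v w. V_orbit Q v w m \<in> U}"
  have "istopology (\<lambda>U. U \<subseteq> M0 Q v w \<and> openin ?T (?P U))"
    unfolding istopology_def
  proof (intro conjI allI impI)
    fix S S' assume "S \<subseteq> M0 Q v w \<and> openin ?T (?P S)" "S' \<subseteq> M0 Q v w \<and> openin ?T (?P S')"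
    moreover have "?P (S \<inter> S') = ?P S \<inter> ?P S'" by auto
    ultimately show "S \<inter> S' \<subseteq> M0 Q v w" "openin ?T (?P (S \<inter> S'))" by auto
  next
    fix K assume K: "\<forall>U\<in>K. U \<subseteq> M0 Q v w \<and> openin ?T (?P U)"
    then show "\<Union>K \<subseteq> M0 Q v w" by auto
    have "?P (\<Union>K) = \<Union>(?P ` K)" by auto
    then show "openin ?T (?P (\<Union>K))" using K by auto
  qed
  then show ?thesis by (simp add: M0_top_def topology_inverse')
qed

text \<open>A map of \<open>M\<close> that carries orbits onto orbits induces a map of \<open>M0\<close> by taking images
  of orbits.\<close>

definition induced :: "(('k, 'h) qrep \<Rightarrow> ('k, 'h) qrep) \<Rightarrow> ('k, 'h) qrep set \<Rightarrow> ('k, 'h) qrep set" where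
  "induced F p = F ` p"

definition W_act ::
  "('k, 'h) pre_digraph \<Rightarrow> ('k \<Rightarrow> nat) \<Rightarrow> ('k \<Rightarrow> nat)
    \<Rightarrow> ('k \<Rightarrow> complex mat) \<Rightarrow> ('k, 'h) qrep set \<Rightarrow> ('k, 'h) qrep set" where
  "W_act Q v w g' = induced (rep_act Q v w \<one>\<^bsub>GL_group Q v\<^esub> g')"

definition M0_scale ::
  "('k, 'h) pre_digraph \<Rightarrow> real \<Rightarrow> ('k, 'h) qrep set \<Rightarrow> ('k, 'h) qrep set" where
  "M0_scale Q t = induced (rep_scale Q t)"

definition alpha0 :: "('k, 'h) pre_digraph \<Rightarrow> ('k, 'h) qrep set \<Rightarrow> ('k, 'h) qrep set" where
  "alpha0 Q = induced (cx_I Q) \<circ> induced (rep_conj Q)"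

definition alpha1 :: "('k, 'h) pre_digraph \<Rightarrow> ('k, 'h) qrep set \<Rightarrow> ('k, 'h) qrep set" where
  "alpha1 Q = induced (cx_K Q) \<circ> induced (rep_conj Q)"

definition M0_real :: "('k, 'h) pre_digraph \<Rightarrow> ('k \<Rightarrow> nat) \<Rightarrow> ('k \<Rightarrow> nat) \<Rightarrow> ('k, 'h) qrep set set" where
  "M0_real Q v w = {p \<in> M0 Q v w. alpha0 Q p = p}"

definition M0_sym :: "('k, 'h) pre_digraph \<Rightarrow> ('k \<Rightarrow> nat) \<Rightarrow> ('k \<Rightarrow> nat) \<Rightarrow> ('k, 'h) qrep set set" where
  "M0_sym Q v w = {p \<in> M0 Q v w. alpha1 Q p = p}"

definition conjugate_in :: "('g, 'a) monoid_scheme \<Rightarrow> 'g set \<Rightarrow> 'g set \<Rightarrow> bool" where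
  "conjugate_in G A B \<longleftrightarrow>
     (\<exists>u\<in>carrier G. A = (\<lambda>l. u \<otimes>\<^bsub>G\<^esub> l \<otimes>\<^bsub>G\<^esub> inv\<^bsub>G\<^esub> u) ` B)"

definition stratum ::
  "('k, 'h) pre_digraph \<Rightarrow> ('k \<Rightarrow> nat) \<Rightarrow> ('k \<Rightarrow> nat) \<Rightarrow> ('k \<Rightarrow> complex mat) set
    \<Rightarrow> ('k, 'h) qrep set set" where
  "stratum Q v w L =
     V_orbit Q v w ` {m \<in> mu_zero Q v w. conjugate_in (U_group Q v) (V_stab Q v w m) L}"

definition real_leaves ::
  "('k, 'h) pre_digraph \<Rightarrow> ('k \<Rightarrow> nat) \<Rightarrow> ('k \<Rightarrow> nat) \<Rightarrow> ('k, 'h) qrep set set set" where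
  "real_leaves Q v w = (\<Union>L\<in>{L. subgroup L (U_group Q v)}.
     connected_components_of (subtopology (M0_top Q v w) (stratum Q v w L \<inter> M0_real Q v w)))"

definition sym_leaves ::
  "('k, 'h) pre_digraph \<Rightarrow> ('k \<Rightarrow> nat) \<Rightarrow> ('k \<Rightarrow> nat) \<Rightarrow> ('k, 'h) qrep set set set" where
  "sym_leaves Q v w = (\<Union>L\<in>{L. subgroup L (U_group Q v)}.
     connected_components_of (subtopology (M0_top Q v w) (stratum Q v w L \<inter> M0_sym Q v w)))"

section \<open>Real analyticity\<close>

text \<open>
  \<open>real_analytic_at I F a\<close>: near \<open>a\<close>, the function \<open>F\<close> on \<open>\<real>\<^sup>I\<close> (extensional functions, \<open>I\<close>
  finite) is the sum of a convergent power series, indexed by the multi-indices \<open>\<alpha> \<in> \<nat>\<^sup>I\<close>.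
\<close>

definition real_analytic_at :: "'i set \<Rightarrow> (('i \<Rightarrow> real) \<Rightarrow> real) \<Rightarrow> ('i \<Rightarrow> real) \<Rightarrow> bool" where
  "real_analytic_at I F a \<longleftrightarrow>
     (\<exists>(c :: ('i \<Rightarrow> nat) \<Rightarrow> real) r. r > 0 \<and>
        (\<forall>x \<in> I \<rightarrow>\<^sub>E UNIV. (\<forall>i\<in>I. \<bar>x i - a i\<bar> < r) \<longrightarrow>
           ((\<lambda>\<alpha>. c \<alpha> * (\<Prod>i\<in>I. (x i - a i) ^ \<alpha> i)) has_sum F x) (I \<rightarrow>\<^sub>E UNIV)))"

text \<open>
  A leaf is a real analytic manifold: its preimage in \<open>mu_zero\<close> is a real analytic submanifold of
  \<open>M\<close> and the leaf has the quotient structure. Hence a function \<open>u\<close> on an open subset \<open>S\<close> of a leaf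
  is real analytic iff its pullback to the preimage of \<open>S\<close> is real analytic, i.e. is locally the
  restriction of a real analytic function on the vector space \<open>M\<close>. (The preimage of \<open>S\<close> is the union
  of the orbits \<open>p \<in> S\<close>, and the pullback has constant value \<open>u p\<close> on \<open>p\<close>.)
\<close>

definition M0_analytic_fun ::
  "('k, 'h) pre_digraph \<Rightarrow> ('k \<Rightarrow> nat) \<Rightarrow> ('k \<Rightarrow> nat) \<Rightarrow> ('k, 'h) qrep set set
    \<Rightarrow> (('k, 'h) qrep set \<Rightarrow> real) \<Rightarrow> bool" where
  "M0_analytic_fun Q v w S u \<longleftrightarrow>
     (\<forall>p\<in>S. \<forall>m\<in>p. \<exists>F r. r > 0 \<and> real_analytic_at (coord_set Q v w) F (coords Q v w m) \<and>
        (\<forall>p'\<in>S. \<forall>m'\<in>p'.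
           (\<forall>i\<in>coord_set Q v w. \<bar>coords Q v w m' i - coords Q v w m i\<bar> < r) \<longrightarrow>
           u p' = F (coords Q v w m')))"

text \<open>A continuous map of real analytic manifolds is real analytic iff it pulls back real analytic
  functions on open sets to such functions.\<close>

definition M0_analytic_map ::
  "('k, 'h) pre_digraph \<Rightarrow> ('k \<Rightarrow> nat) \<Rightarrow> ('k \<Rightarrow> nat) \<Rightarrow> ('k, 'h) qrep set set \<Rightarrow> ('k, 'h) qrep set set
    \<Rightarrow> (('k, 'h) qrep set \<Rightarrow> ('k, 'h) qrep set) \<Rightarrow> bool" where
  "M0_analytic_map Q v w S T f \<longleftrightarrow>
     continuous_map (subtopology (M0_top Q v w) S) (subtopology (M0_top Q v w) T) f \<and>
     (\<forall>U u. openin (subtopology (M0_top Q v w) T) U \<and> M0_analytic_fun Q v w U u \<longrightarrow>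
        M0_analytic_fun Q v w (S \<inter> f -` U) (u \<circ> f))"

definition M0_analytic_iso ::
  "('k, 'h) pre_digraph \<Rightarrow> ('k \<Rightarrow> nat) \<Rightarrow> ('k \<Rightarrow> nat) \<Rightarrow> ('k, 'h) qrep set set \<Rightarrow> ('k, 'h) qrep set set
    \<Rightarrow> (('k, 'h) qrep set \<Rightarrow> ('k, 'h) qrep set) \<Rightarrow> bool" where
  "M0_analytic_iso Q v w S T f \<longleftrightarrow>
     (\<exists>g. M0_analytic_map Q v w S T f \<and> M0_analytic_map Q v w T S g \<and>
        (\<forall>p\<in>S. g (f p) = p) \<and> (\<forall>q\<in>T. f (g q) = q))"

end

theory Submission
  imports Defs
begin

text \<open>
  The unit quaternion \<open>q = (1 - j) / \<surd>2\<close> satisfies \<open>q i q\<inverse> = k\<close>, and \<open>J\<close> commutes with the split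
  conjugation \<open>\<eta>\<close>. Hence \<open>\<phi>(q)\<close> conjugates \<open>\<alpha>\<^sub>0 = \<phi>(i) \<circ> \<eta>\<close> into \<open>\<alpha>\<^sub>1 = \<phi>(k) \<circ> \<eta>\<close> and carries one fixed
  point set onto the other. On \<open>M\<close> it is an invertible real linear map that commutes with the
  unitary groups and with real scalars and mixes \<open>\<mu>\<^sub>\<real>\<close> with the hermitian part of \<open>\<mu>\<^sub>\<complex>\<close>; so it
  preserves the common zero set, the stabilizers and therefore the strata. Real analyticity is
  invariant under linear substitution because a power series converging on a cube can be rearranged absolutely.
\<close>

section \<open>Linear substitution in real analytic functions\<close>

text \<open>A pair \<open>(i, t)\<close> with \<open>t < \<alpha> i\<close> stands for one linear factor of the product, and \<open>\<phi>\<close> picks a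
  summand in every factor.\<close>

lemma prod_power_sum_expand:
  fixes l :: "'i \<Rightarrow> 'j \<Rightarrow> real" and x :: "'j \<Rightarrow> real" and \<alpha> :: "'i \<Rightarrow> nat"
  assumes "finite I" "finite J"
  shows "(\<Prod>i\<in>I. (\<Sum>j\<in>J. l i j * x j) ^ \<alpha> i) =
    (\<Sum>\<phi>\<in>(SIGMA i:I. {..<\<alpha> i}) \<rightarrow>\<^sub>E J.
      (\<Prod>p\<in>(SIGMA i:I. {..<\<alpha> i}). l (fst p) (\<phi> p)) *
      (\<Prod>j\<in>J. x j ^ card {p \<in> (SIGMA i:I. {..<\<alpha> i}). \<phi> p = j}))"
proof -
  let ?K = "SIGMA i:I. {..<\<alpha> i}"
  have finK: "finite ?K" using assms by auto
  have "(\<Prod>i\<in>I. (\<Sum>j\<in>J. l i j * x j) ^ \<alpha> i) = (\<Prod>i\<in>I. \<Prod>t<\<alpha> i. \<Sum>j\<in>J. l i j * x j)"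
    by simp
  also have "\<dots> = (\<Prod>p\<in>?K. \<Sum>j\<in>J. l (fst p) j * x j)"
    using assms by (subst prod.Sigma) (auto simp: case_prod_beta)
  also have "\<dots> = (\<Sum>\<phi>\<in>?K \<rightarrow>\<^sub>E J. \<Prod>p\<in>?K. l (fst p) (\<phi> p) * x (\<phi> p))"
    using finK assms by (subst prod_sum_PiE) auto
  also have "\<dots> = (\<Sum>\<phi>\<in>?K \<rightarrow>\<^sub>E J. (\<Prod>p\<in>?K. l (fst p) (\<phi> p)) *
      (\<Prod>j\<in>J. x j ^ card {p \<in> ?K. \<phi> p = j}))"
  proof (rule sum.cong[OF refl])
    fix \<phi> assume "\<phi> \<in> ?K \<rightarrow>\<^sub>E J"
    then have "\<phi> ` ?K \<subseteq> J" by blast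
    then have "(\<Prod>p\<in>?K. x (\<phi> p)) = (\<Prod>j\<in>J. \<Prod>p\<in>{p \<in> ?K. \<phi> p = j}. x (\<phi> p))"
      by (rule prod.group[OF finK assms(2), symmetric])
    also have "\<dots> = (\<Prod>j\<in>J. x j ^ card {p \<in> ?K. \<phi> p = j})" by simp
    finally show "(\<Prod>p\<in>?K. l (fst p) (\<phi> p) * x (\<phi> p)) = (\<Prod>p\<in>?K. l (fst p) (\<phi> p)) *
      (\<Prod>j\<in>J. x j ^ card {p \<in> ?K. \<phi> p = j})" by (simp add: prod.distrib)
  qed
  finally show ?thesis .
qed

text \<open>The restriction to \<open>I\<close> puts the value among the extensional functions, the
  only points at which \<open>real_analytic_at I\<close> describes a function.\<close>

definition linear_subst :: "'i set \<Rightarrow> 'j set \<Rightarrow> ('i \<Rightarrow> 'j \<Rightarrow> real) \<Rightarrow> ('j \<Rightarrow> real) \<Rightarrow> 'i \<Rightarrow> real" where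
  "linear_subst I J l x = (\<lambda>i\<in>I. \<Sum>j\<in>J. l i j * x j)"

text \<open>Absolute values stand inside the sum because the analyticity proof evaluates a power
  series at this majorant, not only at the linear form. The same radius \<open>\<delta>\<close> also
  serves to shrink neighbourhoods of points of the representation space.\<close>

lemma linear_subst_small:
  fixes l :: "'i \<Rightarrow> 'j \<Rightarrow> real" and r :: real
  assumes "finite I" "finite J" "r > 0"
  shows "\<exists>\<delta>>0. \<forall>d. (\<forall>j\<in>J. \<bar>d j\<bar> < \<delta>) \<longrightarrow> (\<forall>i\<in>I. (\<Sum>j\<in>J. \<bar>l i j\<bar> * \<bar>d j\<bar>) < r)"
proof -
  define C where "C = (\<Sum>i\<in>I. \<Sum>j\<in>J. \<bar>l i j\<bar>)"
  have C0: "C \<ge> 0" by (simp add: C_def sum_nonneg)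
  show ?thesis
  \<comment> \<open>Dividing by \<open>C + 1\<close> keeps the radius positive when all coefficients
    vanish and makes the final inequality strict.\<close>
  proof (intro exI[of _ "r / (C + 1)"] conjI allI impI ballI)
    show "r / (C + 1) > 0" using \<open>r > 0\<close> C0 by auto
    fix d i assume d: "\<forall>j\<in>J. \<bar>d j\<bar> < r / (C + 1)" and "i \<in> I"
    have "(\<Sum>j\<in>J. \<bar>l i j\<bar> * \<bar>d j\<bar>) \<le> (\<Sum>j\<in>J. \<bar>l i j\<bar> * (r / (C + 1)))"
      by (intro sum_mono mult_left_mono) (use d in \<open>auto intro: less_imp_le\<close>)
    also have "\<dots> = (\<Sum>j\<in>J. \<bar>l i j\<bar>) * (r / (C + 1))" by (simp only: sum_distrib_right)
    also have "\<dots> \<le> C * (r / (C + 1))"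
    proof (rule mult_right_mono)
      show "(\<Sum>j\<in>J. \<bar>l i j\<bar>) \<le> C"
        unfolding C_def by (rule member_le_sum[of i I "\<lambda>i. \<Sum>j\<in>J. \<bar>l i j\<bar>"]) (use \<open>i \<in> I\<close> \<open>finite I\<close> in \<open>auto intro!: sum_nonneg\<close>)
      show "0 \<le> r / (C + 1)" using C0 \<open>r > 0\<close> by simp
    qed
    also have "\<dots> < r" using C0 \<open>r > 0\<close> by (simp add: field_simps)
    finally show "(\<Sum>j\<in>J. \<bar>l i j\<bar> * \<bar>d j\<bar>) < r" .
  qed
qed

lemma linear_subst_diff:
  "i \<in> I \<Longrightarrow> linear_subst I J l x i - linear_subst I J l a i = (\<Sum>j\<in>J. l i j * (x j - a j))"
  by (simp add: linear_subst_def sum_subtractf right_diff_distrib)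

lemma linear_subst_diff_le:
  "i \<in> I \<Longrightarrow> \<bar>linear_subst I J l x i - linear_subst I J l a i\<bar> \<le> (\<Sum>j\<in>J. \<bar>l i j\<bar> * \<bar>x j - a j\<bar>)"
  using sum_abs[of "\<lambda>j. l i j * (x j - a j)" J] by (simp add: linear_subst_diff abs_mult)

text \<open>Expanding every power of a linear form turns the series into one over pairs
  \<open>(\<alpha>, \<phi>)\<close>. Absolute summability over these pairs permits regrouping them
  by the exponent of the resulting monomial in the new variables.\<close>

lemma real_analytic_at_linear_subst:
  assumes finI: "finite I" and finJ: "finite J"
    and F: "real_analytic_at I F (linear_subst I J l a)"
  shows "real_analytic_at J (F \<circ> linear_subst I J l) a"
proof -
  let ?b = "linear_subst I J l a"
  from F obtain c r where r: "r > 0" and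
    c': "\<forall>y \<in> I \<rightarrow>\<^sub>E UNIV. (\<forall>i\<in>I. \<bar>y i - ?b i\<bar> < r) \<longrightarrow>
           ((\<lambda>\<alpha>. c \<alpha> * (\<Prod>i\<in>I. (y i - ?b i) ^ \<alpha> i)) has_sum F y) (I \<rightarrow>\<^sub>E UNIV)"
    unfolding real_analytic_at_def by (elim exE conjE)
  have c: "((\<lambda>\<alpha>. c \<alpha> * (\<Prod>i\<in>I. (y i - ?b i) ^ \<alpha> i)) has_sum F y) (I \<rightarrow>\<^sub>E UNIV)"
    if "y \<in> I \<rightarrow>\<^sub>E UNIV" "\<And>i. i \<in> I \<Longrightarrow> \<bar>y i - ?b i\<bar> < r" for y
    using c'[rule_format, OF that] .
  obtain \<delta> where \<delta>: "\<delta> > 0"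
    "\<forall>d. (\<forall>j\<in>J. \<bar>d j\<bar> < \<delta>) \<longrightarrow> (\<forall>i\<in>I. (\<Sum>j\<in>J. \<bar>l i j\<bar> * \<bar>d j\<bar>) < r)"
    using linear_subst_small[OF finI finJ r, of l] by blast
  let ?A = "I \<rightarrow>\<^sub>E (UNIV :: nat set)" and ?B = "J \<rightarrow>\<^sub>E (UNIV :: nat set)"
  define K where "K \<alpha> = (SIGMA i:I. {..<\<alpha> i})" for \<alpha> :: "'a \<Rightarrow> nat"
  define \<Phi> where "\<Phi> \<alpha> = K \<alpha> \<rightarrow>\<^sub>E J" for \<alpha>
  \<comment> \<open>The pair \<open>(\<alpha>, \<phi>)\<close> yields the coefficient
    \<open>e\<close> times the monomial with exponent \<open>\<beta>\<close>. Restricting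
    \<open>\<beta>\<close> to \<open>J\<close> makes it a multi-index in \<open>?B\<close>.\<close>
  define e where "e = (\<lambda>(\<alpha>, \<phi>). c \<alpha> * (\<Prod>p\<in>K \<alpha>. l (fst p) (\<phi> p)))"
  define \<beta> where "\<beta> = (\<lambda>(\<alpha>, \<phi>). \<lambda>j\<in>J. card {p \<in> K \<alpha>. \<phi> p = j})"
  define mon where "mon d \<gamma> = (\<Prod>j\<in>J. d j ^ \<gamma> j)" for d :: "'b \<Rightarrow> real" and \<gamma> :: "'b \<Rightarrow> nat"
  have fin\<Phi>: "finite (\<Phi> \<alpha>)" for \<alpha>
    unfolding \<Phi>_def K_def using finI finJ by (intro finite_PiE) auto
  \<comment> \<open>Stated for arbitrary \<open>l'\<close> and \<open>d\<close>, since it is applied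
    both to the given values and to their absolute values.\<close>
  have expand: "(\<Prod>i\<in>I. (\<Sum>j\<in>J. l' i j * d j) ^ \<alpha> i) =
      (\<Sum>\<phi>\<in>\<Phi> \<alpha>. (\<Prod>p\<in>K \<alpha>. l' (fst p) (\<phi> p)) * mon d (\<beta> (\<alpha>, \<phi>)))" for l' d \<alpha>
    unfolding \<Phi>_def K_def mon_def \<beta>_def
    by (subst prod_power_sum_expand[OF finI finJ]) (auto intro!: sum.cong prod.cong)
  \<comment> \<open>The new coefficient at \<open>\<gamma>\<close> gathers all pairs with exponent
    \<open>\<gamma>\<close>; it is independent of the point \<open>x\<close>, as a power series
    requires.\<close>
  define g where "g \<gamma> = infsum e {z \<in> Sigma ?A \<Phi>. \<beta> z = \<gamma>}" for \<gamma>
  have main: "((\<lambda>\<gamma>. g \<gamma> * mon (\<lambda>j. x j - a j) \<gamma>) has_sum F (linear_subst I J l x)) ?B"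
    if small: "\<And>j. j \<in> J \<Longrightarrow> \<bar>x j - a j\<bar> < \<delta>" for x
  proof -
    define d where "d j = x j - a j" for j
    \<comment> \<open>Convergence at this point is absolute convergence of the fully expanded series.\<close>
    define y where "y = (\<lambda>i\<in>I. ?b i + (\<Sum>j\<in>J. \<bar>l i j\<bar> * \<bar>d j\<bar>))"
    have small_d: "(\<Sum>j\<in>J. \<bar>l i j\<bar> * \<bar>d j\<bar>) < r" if "i \<in> I" for i
    proof -
      have "\<forall>j\<in>J. \<bar>d j\<bar> < \<delta>" using small by (simp add: d_def)
      then show ?thesis by (rule \<delta>(2)[THEN spec[of _ d], THEN mp, THEN bspec, OF _ that])
    qed
    have pos: "0 \<le> (\<Sum>j\<in>J. \<bar>l i j\<bar> * \<bar>d j\<bar>)" for i by (intro sum_nonneg) auto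
    have "((\<lambda>\<alpha>. c \<alpha> * (\<Prod>i\<in>I. (y i - ?b i) ^ \<alpha> i)) has_sum F y) ?A"
      by (rule c) (use small_d pos in \<open>auto simp: y_def\<close>)
    then have "(\<lambda>\<alpha>. c \<alpha> * (\<Prod>i\<in>I. (y i - ?b i) ^ \<alpha> i)) summable_on ?A"
      by (rule has_sum_imp_summable)
    then have "(\<lambda>\<alpha>. \<bar>c \<alpha> * (\<Prod>i\<in>I. (y i - ?b i) ^ \<alpha> i)\<bar>) summable_on ?A"
      by (subst (asm) summable_on_iff_abs_summable_on_real) (simp only: real_norm_def)
    also have "(\<lambda>\<alpha>. \<bar>c \<alpha> * (\<Prod>i\<in>I. (y i - ?b i) ^ \<alpha> i)\<bar>) =
        (\<lambda>\<alpha>. \<Sum>\<phi>\<in>\<Phi> \<alpha>. \<bar>e (\<alpha>, \<phi>) * mon d (\<beta> (\<alpha>, \<phi>))\<bar>)"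
    proof
      fix \<alpha>
      have "(\<Prod>i\<in>I. (y i - ?b i) ^ \<alpha> i) = (\<Prod>i\<in>I. (\<Sum>j\<in>J. \<bar>l i j\<bar> * \<bar>d j\<bar>) ^ \<alpha> i)"
        by (intro prod.cong) (auto simp: y_def)
      moreover have "0 \<le> (\<Prod>i\<in>I. (\<Sum>j\<in>J. \<bar>l i j\<bar> * \<bar>d j\<bar>) ^ \<alpha> i)"
        by (intro prod_nonneg ballI zero_le_power pos)
      ultimately have "\<bar>c \<alpha> * (\<Prod>i\<in>I. (y i - ?b i) ^ \<alpha> i)\<bar> =
          \<bar>c \<alpha>\<bar> * (\<Sum>\<phi>\<in>\<Phi> \<alpha>. (\<Prod>p\<in>K \<alpha>. \<bar>l (fst p) (\<phi> p)\<bar>) * mon (\<lambda>j. \<bar>d j\<bar>) (\<beta> (\<alpha>, \<phi>)))"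
        using expand[of "\<lambda>i j. \<bar>l i j\<bar>" "\<lambda>j. \<bar>d j\<bar>"] by (simp add: abs_mult)
      also have "\<dots> = (\<Sum>\<phi>\<in>\<Phi> \<alpha>. \<bar>e (\<alpha>, \<phi>) * mon d (\<beta> (\<alpha>, \<phi>))\<bar>)"
        by (simp add: e_def mon_def abs_mult abs_prod power_abs sum_distrib_left mult.assoc)
      finally show "\<bar>c \<alpha> * (\<Prod>i\<in>I. (y i - ?b i) ^ \<alpha> i)\<bar> =
          (\<Sum>\<phi>\<in>\<Phi> \<alpha>. \<bar>e (\<alpha>, \<phi>) * mon d (\<beta> (\<alpha>, \<phi>))\<bar>)" .
    qed
    \<comment> \<open>Each \<open>\<Phi> \<alpha>\<close> is finite, so summability of the iterated
      absolute sums is absolute summability over all pairs.\<close>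
    finally have "(\<lambda>z. norm (e z * mon d (\<beta> z))) summable_on Sigma ?A \<Phi>"
      using Infinite_Sum.abs_summable_on_Sigma_iff[of "\<lambda>z. e z * mon d (\<beta> z)" ?A \<Phi>]
      by (simp add: fin\<Phi> summable_on_finite)
    then have summ: "(\<lambda>z. e z * mon d (\<beta> z)) summable_on Sigma ?A \<Phi>"
      by (rule summable_on_iff_abs_summable_on_real[THEN iffD2])
    have "((\<lambda>\<alpha>. c \<alpha> * (\<Prod>i\<in>I. (linear_subst I J l x i - ?b i) ^ \<alpha> i)) has_sum
        F (linear_subst I J l x)) ?A"
    proof (rule c)
      show "linear_subst I J l x \<in> I \<rightarrow>\<^sub>E UNIV" by (simp add: linear_subst_def)
      show "\<bar>linear_subst I J l x i - ?b i\<bar> < r" if "i \<in> I" for i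
        using linear_subst_diff_le[OF that] small_d[OF that] unfolding d_def by (rule le_less_trans)
    qed
    also have "(\<lambda>\<alpha>. c \<alpha> * (\<Prod>i\<in>I. (linear_subst I J l x i - ?b i) ^ \<alpha> i)) =
        (\<lambda>\<alpha>. \<Sum>\<phi>\<in>\<Phi> \<alpha>. e (\<alpha>, \<phi>) * mon d (\<beta> (\<alpha>, \<phi>)))"
    proof
      fix \<alpha>
      have "(\<Prod>i\<in>I. (linear_subst I J l x i - ?b i) ^ \<alpha> i) = (\<Prod>i\<in>I. (\<Sum>j\<in>J. l i j * d j) ^ \<alpha> i)"
        by (intro prod.cong) (auto simp: linear_subst_diff d_def)
      then show "c \<alpha> * (\<Prod>i\<in>I. (linear_subst I J l x i - ?b i) ^ \<alpha> i) =
          (\<Sum>\<phi>\<in>\<Phi> \<alpha>. e (\<alpha>, \<phi>) * mon d (\<beta> (\<alpha>, \<phi>)))"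
        using expand[of l d \<alpha>] by (simp add: e_def sum_distrib_left mult.assoc)
    qed
    finally have "((\<lambda>z. e z * mon d (\<beta> z)) has_sum F (linear_subst I J l x)) (Sigma ?A \<Phi>)"
      using summ fin\<Phi> by (intro has_sum_SigmaI) (auto intro: has_sum_finite)
    \<comment> \<open>Tagging each pair with its exponent splits the index set into the fibres of
      \<open>\<beta>\<close>; summing fibre by fibre then gives the rearranged series.\<close>
    also have "?this \<longleftrightarrow> ((\<lambda>z. e (snd z) * mon d (\<beta> (snd z))) has_sum F (linear_subst I J l x))
        (Sigma ?B (\<lambda>\<gamma>. {z \<in> Sigma ?A \<Phi>. \<beta> z = \<gamma>}))"
      by (intro has_sum_reindex_bij_witness[of _ snd "\<lambda>z. (\<beta> z, z)"]) (auto simp: \<beta>_def)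
    finally have total: "((\<lambda>z. e (snd z) * mon d (\<beta> (snd z))) has_sum F (linear_subst I J l x))
        (Sigma ?B (\<lambda>\<gamma>. {z \<in> Sigma ?A \<Phi>. \<beta> z = \<gamma>}))" .
    show ?thesis
    proof (rule has_sum_Sigma'[OF total])
      fix \<gamma> assume "\<gamma> \<in> ?B"
      let ?S = "{z \<in> Sigma ?A \<Phi>. \<beta> z = \<gamma>}"
      have "(\<lambda>z. e z * mon d (\<beta> z)) summable_on ?S"
        by (rule summable_on_subset_banach[OF summ]) auto
      then have "((\<lambda>z. e z * mon d (\<beta> z)) has_sum infsum (\<lambda>z. e z * mon d (\<beta> z)) ?S) ?S"
        by (rule has_sum_infsum)
      also have "infsum (\<lambda>z. e z * mon d (\<beta> z)) ?S = infsum (\<lambda>z. e z * mon d \<gamma>) ?S"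
        by (rule infsum_cong) auto
      \<comment> \<open>On the fibre the monomial is a constant factor; it leaves the infinite sum
        even where it vanishes.\<close>
      also have "\<dots> = g \<gamma> * mon d \<gamma>"
        unfolding g_def by (rule infsum_cmult_left')
      finally show "((\<lambda>z. e (snd (\<gamma>, z)) * mon d (\<beta> (snd (\<gamma>, z)))) has_sum
          g \<gamma> * mon (\<lambda>j. x j - a j) \<gamma>) ?S"
        by (simp add: d_def[abs_def])
    qed
  qed
  show ?thesis
    unfolding real_analytic_at_def
    by (rule exI[of _ g], rule exI[of _ \<delta>]) (use \<delta>(1) main in \<open>auto simp: mon_def o_def\<close>)
qed

section \<open>The quaternionic rotation on the representation space\<close>

lemma mat_adjoint_carrier [simp]:
  "A \<in> carrier_mat n m \<Longrightarrow> mat_adjoint A \<in> carrier_mat m n"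
  by (auto simp: mat_adjoint_def)

lemma dim_mat_adjoint [simp]:
  "dim_row (mat_adjoint A) = dim_col A" "dim_col (mat_adjoint A) = dim_row A"
  by (auto simp: mat_adjoint_def)

lemma index_mat_adjoint [simp]:
  fixes A :: "complex mat"
  assumes "i < dim_col A" "j < dim_row A"
  shows "mat_adjoint A $$ (i, j) = cnj (A $$ (j, i))"
  using assms by (simp add: mat_adjoint_def mat_of_rows_def conjugate_complex_def)

lemma mat_adjoint_mat_adjoint [simp]: "mat_adjoint (mat_adjoint A) = (A :: complex mat)"
  by (rule eq_matI) auto

lemma mat_adjoint_mult:
  fixes A B :: "complex mat"
  assumes "A \<in> carrier_mat n p" "B \<in> carrier_mat p q"
  shows "mat_adjoint (A * B) = mat_adjoint B * mat_adjoint A"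
  by (rule eq_matI) (use assms in \<open>auto simp: scalar_prod_def mult.commute intro!: sum.cong\<close>)

lemma mat_adjoint_one [simp]: "mat_adjoint (1\<^sub>m n :: complex mat) = 1\<^sub>m n"
  by (rule eq_matI) auto

text \<open>A right inverse of a square matrix is a left inverse too, so the abstract inverse in the
  unit group is the adjoint. This is what lets the group action be compared with adjoints in the
  rotation.\<close>

lemma U_mat_carrierD:
  assumes "A \<in> carrier (U_mat n)"
  shows "A \<in> carrier_mat n n" "inv\<^bsub>GL_mat n\<^esub> A = mat_adjoint A"
proof -
  let ?R = "ring_mat TYPE(complex) n ()"
  interpret R: ring ?R by (rule ring_mat)
  from assms have A: "A \<in> Units ?R" "A * mat_adjoint A = 1\<^sub>m n"
    by (auto simp: U_mat_def GL_mat_def units_of_carrier)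
  then show carr: "A \<in> carrier_mat n n"
    using R.Units_closed by (auto simp: ring_mat_simps)
  have "mat_adjoint A * A = 1\<^sub>m n"
    using mat_mult_left_right_inverse[OF carr _ A(2)] carr by simp
  then have "inv\<^bsub>?R\<^esub> A = mat_adjoint A"
    by (intro R.inv_char) (use A carr in \<open>auto simp: ring_mat_simps\<close>)
  then show "inv\<^bsub>GL_mat n\<^esub> A = mat_adjoint A"
    using A(1) by (simp add: GL_mat_def R.units_of_inv)
qed

lemma one_in_U_mat: "\<one>\<^bsub>GL_mat n\<^esub> \<in> carrier (U_mat n)"
proof -
  interpret R: ring "ring_mat TYPE(complex) n ()" by (rule ring_mat)
  show ?thesis
    using R.Units_one_closed by (simp add: U_mat_def GL_mat_def units_of_carrier units_of_one ring_mat_simps)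
qed

lemma one_in_U_group: "\<one>\<^bsub>GL_group Q d\<^esub> \<in> carrier (U_group Q d)"
  by (auto simp: GL_group_def U_group_def one_in_U_mat)

section \<open>The rotation on a dual pair of matrices\<close>

definition half_root :: complex where "half_root = complex_of_real (1 / sqrt 2)"

lemma cnj_half_root [simp]: "cnj half_root = half_root"
  by (simp add: half_root_def)

lemma half_root_sq: "half_root * half_root = 1 / 2"
proof -
  have "half_root * half_root = complex_of_real ((1 / sqrt 2) * (1 / sqrt 2))"
    by (simp only: of_real_mult half_root_def)
  also have "(1 / sqrt 2) * (1 / sqrt 2) = (1 / 2 :: real)" by simp
  finally show ?thesis by simp
qed

lemma half_root_sq': "half_root * (half_root * z) = z / 2"
  unfolding mult.assoc[symmetric] half_root_sq by simp

text \<open>One component of \<open>(1 - J) / \<surd>2\<close> or of its inverse. \<open>J\<close>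
  puts an adjoint with a minus sign into the \<open>X\<close> and \<open>x\<close> slots and with a
  plus sign into the \<open>Y\<close> and \<open>y\<close> slots, so \<open>e\<close> also absorbs
  the sign of the slot.\<close>

definition rotate_mat :: "real \<Rightarrow> complex mat \<Rightarrow> complex mat \<Rightarrow> complex mat" where
  "rotate_mat e A B = half_root \<cdot>\<^sub>m (A + complex_of_real e \<cdot>\<^sub>m mat_adjoint B)"

lemma rotate_mat_carrier [simp]:
  "A \<in> carrier_mat n p \<Longrightarrow> B \<in> carrier_mat p n \<Longrightarrow> rotate_mat e A B \<in> carrier_mat n p"
  by (simp add: rotate_mat_def)

lemma index_rotate_mat:
  assumes "A \<in> carrier_mat n p" "B \<in> carrier_mat p n" "i < n" "j < p"
  shows "rotate_mat e A B $$ (i, j) = half_root * (A $$ (i, j) + complex_of_real e * cnj (B $$ (j, i)))"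
  using assms by (simp add: rotate_mat_def)

text \<open>Multiplying out, the skew-hermitian part of \<open>A * B\<close> survives in the
  product, while its hermitian part is exchanged with the real moment expression, in which the
  squares cancel. This is a quarter turn of the moment components about the axis of
  \<open>j\<close>. The partner matrix is rotated with \<open>- e\<close> because it sits in the
  dual slot.\<close>

lemma rotate_mat_mult_index:
  assumes A: "A \<in> carrier_mat n p" and B: "B \<in> carrier_mat p n" and ab: "a < n" "b < n"
    and e: "e * e = 1"
  shows "(rotate_mat e A B * rotate_mat (- e) B A) $$ (a, b) =
     ((A * B) $$ (a, b) - cnj ((A * B) $$ (b, a))
       - complex_of_real e * (A * mat_adjoint A - mat_adjoint B * B) $$ (a, b)) / 2" (is ?g1)
    and "(rotate_mat e A B * mat_adjoint (rotate_mat e A B)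
       - mat_adjoint (rotate_mat (- e) B A) * rotate_mat (- e) B A) $$ (a, b) =
     complex_of_real e * ((A * B) $$ (a, b) + cnj ((A * B) $$ (b, a)))" (is ?g2)
proof -
  let ?e = "complex_of_real e"
  have e2: "?e * ?e = 1" using e by (metis of_real_1 of_real_mult)
  have e3: "?e * (?e * z) = z" for z using e2 by (simp add: mult.assoc[symmetric])
  have A': "rotate_mat e A B \<in> carrier_mat n p" and B': "rotate_mat (- e) B A \<in> carrier_mat p n"
    using A B by auto
  note dims = carrier_matD[OF A] carrier_matD[OF B] carrier_matD[OF A'] carrier_matD[OF B']
  have "(rotate_mat e A B * rotate_mat (- e) B A) $$ (a, b) =
      (\<Sum>l=0..<p. half_root * (half_root * ((A $$ (a, l) + ?e * cnj (B $$ (l, a))) *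
        (B $$ (l, b) - ?e * cnj (A $$ (b, l))))))"
    using ab by (simp add: dims scalar_prod_def index_rotate_mat[OF A B] index_rotate_mat[OF B A] mult.assoc mult.left_commute)
  also have "\<dots> = (\<Sum>l=0..<p. (A $$ (a, l) * B $$ (l, b) - cnj (A $$ (b, l) * B $$ (l, a))
       - ?e * (A $$ (a, l) * cnj (A $$ (b, l)) - cnj (B $$ (l, a)) * B $$ (l, b))) / 2)"
    by (intro sum.cong refl) (simp add: half_root_sq' algebra_simps e3)
  also have "\<dots> = ((A * B) $$ (a, b) - cnj ((A * B) $$ (b, a))
       - ?e * (A * mat_adjoint A - mat_adjoint B * B) $$ (a, b)) / 2"
    using ab by (simp add: dims scalar_prod_def sum_subtractf sum_distrib_left right_diff_distrib sum_divide_distrib[symmetric])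
  finally show ?g1 .
  have "(rotate_mat e A B * mat_adjoint (rotate_mat e A B)
       - mat_adjoint (rotate_mat (- e) B A) * rotate_mat (- e) B A) $$ (a, b) =
     (\<Sum>l=0..<p. half_root * (half_root * ((A $$ (a, l) + ?e * cnj (B $$ (l, a))) *
        cnj (A $$ (b, l) + ?e * cnj (B $$ (l, b))))) -
        half_root * (half_root * (cnj (B $$ (l, a) - ?e * cnj (A $$ (a, l))) *
          (B $$ (l, b) - ?e * cnj (A $$ (b, l))))))"
    using ab by (simp add: dims scalar_prod_def sum_subtractf index_rotate_mat[OF A B] index_rotate_mat[OF B A] mult.assoc mult.left_commute)
  also have "\<dots> = (\<Sum>l=0..<p. ?e * (A $$ (a, l) * B $$ (l, b) + cnj (A $$ (b, l) * B $$ (l, a))))"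
    by (intro sum.cong refl) (simp add: half_root_sq' field_simps e3)
  also have "\<dots> = ?e * ((A * B) $$ (a, b) + cnj ((A * B) $$ (b, a)))"
    using ab by (simp add: dims scalar_prod_def sum.distrib sum_distrib_left distrib_left)
  finally show ?g2 .
qed

text \<open>The opposite Hom space: an adjoint of a matrix in \<open>dual s\<close> has the shape
  required in \<open>s\<close>.\<close>

fun dual :: "('k, 'h) summand \<Rightarrow> ('k, 'h) summand" where
  "dual (ArrX h) = ArrY h"
| "dual (ArrY h) = ArrX h"
| "dual (FrX k) = FrY k"
| "dual (FrY k) = FrX k"

text \<open>The sign before the adjoint in the component \<open>s\<close> of
  \<open>- J\<close>.\<close>

fun dual_sign :: "('k, 'h) summand \<Rightarrow> real" where
  "dual_sign (ArrX h) = 1"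
| "dual_sign (ArrY h) = - 1"
| "dual_sign (FrX k) = 1"
| "dual_sign (FrY k) = - 1"

lemma dual_dual [simp]: "dual (dual s) = s"
  by (cases s) auto

lemma dual_sign_dual [simp]: "dual_sign (dual s) = - dual_sign s"
  by (cases s) auto

lemma dual_sign_sq: "dual_sign s * dual_sign s = 1"
  by (cases s) auto

text \<open>The group component at the target of \<open>s\<close>. The one at the source is
  \<open>cod_elt\<close> of \<open>dual s\<close>, so a single formula describes the action on all
  four kinds of summands.\<close>

fun cod_elt :: "('k, 'h) pre_digraph \<Rightarrow> ('k \<Rightarrow> complex mat) \<Rightarrow> ('k \<Rightarrow> complex mat)
    \<Rightarrow> ('k, 'h) summand \<Rightarrow> complex mat" where
  "cod_elt Q g g' (ArrX h) = g (head Q h)"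
| "cod_elt Q g g' (ArrY h) = g (tail Q h)"
| "cod_elt Q g g' (FrX k) = g k"
| "cod_elt Q g g' (FrY k) = g' k"

text \<open>For \<open>e = 1\<close> this is multiplication by the unit quaternion \<open>(1 - j) / \<surd>2\<close>, for \<open>e = - 1\<close>
  by its inverse \<open>(1 + j) / \<surd>2\<close>.\<close>

definition rep_rotate :: "('k, 'h) pre_digraph \<Rightarrow> real \<Rightarrow> ('k, 'h) qrep \<Rightarrow> ('k, 'h) qrep" where
  "rep_rotate Q e m = (\<lambda>s\<in>summands Q. rotate_mat (e * dual_sign s) (m s) (m (dual s)))"

locale quiver = fin_digraph Q for Q :: "('k, 'h) pre_digraph" +
  fixes v w :: "'k \<Rightarrow> nat"
begin

lemma finite_summands: "finite (summands Q)"
  by (simp add: summands_def)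

lemma dual_in_summands [simp]: "s \<in> summands Q \<Longrightarrow> dual s \<in> summands Q"
  by (auto simp: summands_def)

lemma dim_dual [simp]:
  "cod_dim Q v w (dual s) = dom_dim Q v w s" "dom_dim Q v w (dual s) = cod_dim Q v w s"
  by (cases s; simp)+

lemma rep_space_carrier [simp]:
  "m \<in> rep_space Q v w \<Longrightarrow> s \<in> summands Q \<Longrightarrow> m s \<in> carrier_mat (cod_dim Q v w s) (dom_dim Q v w s)"
  by (auto simp: rep_space_def)

lemma rep_space_carrier_dual [simp]:
  assumes "m \<in> rep_space Q v w" "s \<in> summands Q"
  shows "m (dual s) \<in> carrier_mat (dom_dim Q v w s) (cod_dim Q v w s)"
  using rep_space_carrier[OF assms(1) dual_in_summands[OF assms(2)]] by simp

lemma rep_eqI: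
  assumes "m \<in> rep_space Q v w" "m' \<in> rep_space Q v w" "\<And>s. s \<in> summands Q \<Longrightarrow> m s = m' s"
  shows "m = m'"
  using assms unfolding rep_space_def by (rule PiE_ext)

lemma rep_rotate_rep_space [simp]: "m \<in> rep_space Q v w \<Longrightarrow> rep_rotate Q e m \<in> rep_space Q v w"
  unfolding rep_space_def[of Q v w] rep_rotate_def
  by (rule restrict_PiE_iff[THEN iffD2]) (simp add: rep_space_def[symmetric])

lemma rep_rotate_apply: "s \<in> summands Q \<Longrightarrow> rep_rotate Q e m s = rotate_mat (e * dual_sign s) (m s) (m (dual s))"
  by (simp add: rep_rotate_def)

text \<open>As \<open>J\<close> squares to -1, (1 + e J)(1 - e J) = 1 + e^2 = 2, which the two
  factors \<open>half_root\<close> cancel. In entries, J^2 = -1 is the change of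
  \<open>dual_sign\<close> under \<open>dual\<close>.\<close>

lemma rep_rotate_inverse:
  assumes m: "m \<in> rep_space Q v w" and e: "e * e = 1"
  shows "rep_rotate Q (- e) (rep_rotate Q e m) = m"
proof (rule rep_eqI)
  fix s assume s: "s \<in> summands Q"
  let ?e = "complex_of_real (e * dual_sign s)"
  have "?e * ?e = complex_of_real ((e * e) * (dual_sign s * dual_sign s))"
    by (simp only: of_real_mult mult_ac)
  then have "?e * ?e = 1" using e by (simp add: dual_sign_sq)
  then have ee: "?e * (?e * z) = z" for z by (simp add: mult.assoc[symmetric])
  note c = rep_space_carrier[OF m s] rep_space_carrier_dual[OF m s]
  show "rep_rotate Q (- e) (rep_rotate Q e m) s = m s"
  proof (rule eq_matI)
    fix i j assume "i < dim_row (m s)" "j < dim_col (m s)"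
    then have ij: "i < cod_dim Q v w s" "j < dom_dim Q v w s" using c by auto
    have "rep_rotate Q (- e) (rep_rotate Q e m) s $$ (i, j) =
        half_root * (half_root * ((m s $$ (i, j) + ?e * cnj (m (dual s) $$ (j, i)))
          - ?e * (cnj (m (dual s) $$ (j, i)) - ?e * m s $$ (i, j))))"
      using s ij c by (simp add: rep_rotate_apply index_rotate_mat[where n = "cod_dim Q v w s" and p = "dom_dim Q v w s"]
          index_rotate_mat[where p = "cod_dim Q v w s" and n = "dom_dim Q v w s"] algebra_simps)
    also have "\<dots> = m s $$ (i, j)"
      unfolding half_root_sq' by (simp add: right_diff_distrib ee del: of_real_mult)
    finally show "rep_rotate Q (- e) (rep_rotate Q e m) s $$ (i, j) = m s $$ (i, j)" .
  qed (use s c in \<open>auto simp: rep_rotate_def rotate_mat_def\<close>)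
qed (use m in auto)

lemma inj_on_rep_rotate: "e * e = 1 \<Longrightarrow> inj_on (rep_rotate Q e) (rep_space Q v w)"
  by (rule inj_on_inverseI[where g = "rep_rotate Q (- e)"]) (rule rep_rotate_inverse)

section \<open>Equivariance under the unitary groups\<close>

lemma U_group_carrierD:
  assumes "g \<in> carrier (U_group Q d)" "k \<in> verts Q"
  shows "g k \<in> carrier_mat (d k) (d k)" "inv\<^bsub>GL_mat (d k)\<^esub> g k = mat_adjoint (g k)"
proof -
  have "g k \<in> carrier (U_mat (d k))" using assms by (auto simp: U_group_def)
  then show "g k \<in> carrier_mat (d k) (d k)" "inv\<^bsub>GL_mat (d k)\<^esub> g k = mat_adjoint (g k)"
    using U_mat_carrierD by auto
qed

context
  fixes g g' :: "'k \<Rightarrow> complex mat"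
  assumes g: "g \<in> carrier (U_group Q v)" and g': "g' \<in> carrier (U_group Q w)"
begin

lemma cod_elt_carrier:
  "s \<in> summands Q \<Longrightarrow> cod_elt Q g g' s \<in> carrier_mat (cod_dim Q v w s) (cod_dim Q v w s)"
  using U_group_carrierD(1)[OF g] U_group_carrierD(1)[OF g'] by (auto simp: summands_def)

lemma rep_act_unitary_apply:
  "s \<in> summands Q \<Longrightarrow>
    rep_act Q v w g g' m s = cod_elt Q g g' s * m s * mat_adjoint (cod_elt Q g g' (dual s))"
  using g g' by (auto simp: summands_def rep_act_def U_group_carrierD)

lemma rep_act_rep_space:
  assumes m: "m \<in> rep_space Q v w"
  shows "rep_act Q v w g g' m \<in> rep_space Q v w"
proof -
  have "rep_act Q v w g g' m s \<in> carrier_mat (cod_dim Q v w s) (dom_dim Q v w s)"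
    if s: "s \<in> summands Q" for s
    using rep_space_carrier[OF m s] cod_elt_carrier[OF s] cod_elt_carrier[OF dual_in_summands[OF s]] s
    by (auto simp: rep_act_unitary_apply)
  moreover have "rep_act Q v w g g' m \<in> extensional (summands Q)"
    by (simp add: rep_act_def)
  ultimately show ?thesis by (auto simp: rep_space_def PiE_iff)
qed

text \<open>For unitary elements, the adjoint of the transformed dual component acquires the same
  left and right factors as the component in \<open>s\<close>. Both groups are treated at once;
  setting one element to the identity gives the separate actions.\<close>

lemma rep_rotate_rep_act:
  assumes m: "m \<in> rep_space Q v w"
  shows "rep_rotate Q e (rep_act Q v w g g' m) = rep_act Q v w g g' (rep_rotate Q e m)"
proof (rule rep_eqI)
  fix s assume s: "s \<in> summands Q"
  define p q where "p = cod_dim Q v w s" and "q = dom_dim Q v w s"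
  define L R where "L = cod_elt Q g g' s" and "R = cod_elt Q g g' (dual s)"
  have c: "m s \<in> carrier_mat p q" "m (dual s) \<in> carrier_mat q p"
    "L \<in> carrier_mat p p" "R \<in> carrier_mat q q"
    using m s cod_elt_carrier[OF s] cod_elt_carrier[OF dual_in_summands[OF s]]
    by (auto simp: p_def q_def L_def R_def)
  let ?e = "complex_of_real (e * dual_sign s)"
  have adj: "mat_adjoint (R * m (dual s) * mat_adjoint L) = L * mat_adjoint (m (dual s)) * mat_adjoint R"
  proof -
    have "mat_adjoint (R * m (dual s) * mat_adjoint L) = L * mat_adjoint (R * m (dual s))"
      using c by (subst mat_adjoint_mult[of _ q p _ p]) auto
    also have "\<dots> = L * (mat_adjoint (m (dual s)) * mat_adjoint R)"
      using c by (subst mat_adjoint_mult[of _ q q _ p]) auto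
    also have "\<dots> = L * mat_adjoint (m (dual s)) * mat_adjoint R"
      using c by (subst assoc_mult_mat[of _ p p _ q _ q]) auto
    finally show ?thesis .
  qed
  have "rep_rotate Q e (rep_act Q v w g g' m) s =
      half_root \<cdot>\<^sub>m (L * m s * mat_adjoint R + ?e \<cdot>\<^sub>m (L * mat_adjoint (m (dual s)) * mat_adjoint R))"
    using s by (simp add: rep_rotate_apply rotate_mat_def rep_act_unitary_apply adj[unfolded L_def R_def] L_def R_def)
  also have "\<dots> = L * (half_root \<cdot>\<^sub>m (m s + ?e \<cdot>\<^sub>m mat_adjoint (m (dual s)))) * mat_adjoint R"
    using c by (simp add: mult_smult_distrib[of _ p p _ q] mult_smult_assoc_mat[of _ p q _ q]
        mult_add_distrib_mat[of _ p p _ q] add_mult_distrib_mat[of _ p q _ _ q])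
  also have "\<dots> = rep_act Q v w g g' (rep_rotate Q e m) s"
    using s by (simp add: rep_rotate_apply rotate_mat_def rep_act_unitary_apply L_def R_def)
  finally show "rep_rotate Q e (rep_act Q v w g g' m) s = rep_act Q v w g g' (rep_rotate Q e m) s" .
qed (use m in \<open>simp_all add: rep_act_rep_space\<close>)

end

lemma V_orbit_subset: "m \<in> rep_space Q v w \<Longrightarrow> V_orbit Q v w m \<subseteq> rep_space Q v w"
  by (auto simp: V_orbit_def intro!: rep_act_rep_space one_in_U_group)

lemma V_orbit_rep_rotate:
  assumes "m \<in> rep_space Q v w"
  shows "V_orbit Q v w (rep_rotate Q e m) = rep_rotate Q e ` V_orbit Q v w m"
  unfolding V_orbit_def image_image
  by (intro image_cong refl rep_rotate_rep_act[symmetric] one_in_U_group assms)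

text \<open>An equivariant injection preserves stabilizers exactly, not just up to
  conjugacy.\<close>

lemma V_stab_rep_rotate:
  assumes "m \<in> rep_space Q v w" "e * e = 1"
  shows "V_stab Q v w (rep_rotate Q e m) = V_stab Q v w m"
proof -
  have "rep_act Q v w g \<one>\<^bsub>GL_group Q w\<^esub> (rep_rotate Q e m) = rep_rotate Q e m \<longleftrightarrow>
      rep_act Q v w g \<one>\<^bsub>GL_group Q w\<^esub> m = m" if "g \<in> carrier (U_group Q v)" for g
    unfolding rep_rotate_rep_act[OF that one_in_U_group assms(1), symmetric]
    by (intro inj_on_eq_iff[OF inj_on_rep_rotate[OF assms(2)]] rep_act_rep_space that one_in_U_group assms(1))
  then show ?thesis by (auto simp: V_stab_def)
qed

section \<open>Moment maps under the rotation\<close>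

definition muC_entry where
  "muC_entry m k a b =
     (\<Sum>h | h \<in> arcs Q \<and> head Q h = k. (m (ArrX h) * m (ArrY h)) $$ (a, b))
   - (\<Sum>h | h \<in> arcs Q \<and> tail Q h = k. (m (ArrY h) * m (ArrX h)) $$ (a, b))
   + (m (FrX k) * m (FrY k)) $$ (a, b)"

text \<open>The factor \<open>\<i> / 2\<close> of \<open>mu_R\<close> is omitted; this leaves the
  zero set unchanged.\<close>

definition muR_entry where
  "muR_entry m k a b =
     (\<Sum>h | h \<in> arcs Q \<and> head Q h = k.
       (m (ArrX h) * mat_adjoint (m (ArrX h)) - mat_adjoint (m (ArrY h)) * m (ArrY h)) $$ (a, b))
   + (\<Sum>h | h \<in> arcs Q \<and> tail Q h = k.
       (m (ArrY h) * mat_adjoint (m (ArrY h)) - mat_adjoint (m (ArrX h)) * m (ArrX h)) $$ (a, b))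
   + (m (FrX k) * mat_adjoint (m (FrX k)) - mat_adjoint (m (FrY k)) * m (FrY k)) $$ (a, b)"

lemma Fr_carrier:
  assumes "m \<in> rep_space Q v w" "k \<in> verts Q"
  shows "m (FrX k) \<in> carrier_mat (v k) (w k)" "m (FrY k) \<in> carrier_mat (w k) (v k)"
  using rep_space_carrier[OF assms(1), of "FrX k"] rep_space_carrier[OF assms(1), of "FrY k"] assms(2)
  by (auto simp: summands_def)

lemma Arr_carrier:
  assumes "m \<in> rep_space Q v w" "h \<in> arcs Q"
  shows "m (ArrX h) \<in> carrier_mat (v (head Q h)) (v (tail Q h))"
    "m (ArrY h) \<in> carrier_mat (v (tail Q h)) (v (head Q h))"
  using rep_space_carrier[OF assms(1), of "ArrX h"] rep_space_carrier[OF assms(1), of "ArrY h"] assms(2)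
  by (auto simp: summands_def)

lemma mu_zero_iff:
  "m \<in> mu_zero Q v w \<longleftrightarrow> m \<in> rep_space Q v w \<and>
    (\<forall>k\<in>verts Q. \<forall>a<v k. \<forall>b<v k. muC_entry m k a b = 0 \<and> muR_entry m k a b = 0)"
proof -
  have C: "mu_C Q v m = (\<lambda>k\<in>verts Q. 0\<^sub>m (v k) (v k)) \<longleftrightarrow>
      (\<forall>k\<in>verts Q. \<forall>a<v k. \<forall>b<v k. muC_entry m k a b = 0)" if m: "m \<in> rep_space Q v w"
  proof -
    have "mu_C Q v m k = mat (v k) (v k) (\<lambda>(a, b). muC_entry m k a b)" if "k \<in> verts Q" for k
      using that Fr_carrier[OF m that] by (intro eq_matI) (auto simp: mu_C_def muC_entry_def msum_def)
    moreover have "mu_C Q v m \<in> extensional (verts Q)" by (simp add: mu_C_def)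
    ultimately show ?thesis
      by (auto simp: fun_eq_iff mat_eq_iff extensional_def restrict_def)
  qed
  have R: "mu_R Q v m = (\<lambda>k\<in>verts Q. 0\<^sub>m (v k) (v k)) \<longleftrightarrow>
      (\<forall>k\<in>verts Q. \<forall>a<v k. \<forall>b<v k. muR_entry m k a b = 0)" if m: "m \<in> rep_space Q v w"
  proof -
    have "mu_R Q v m k = mat (v k) (v k) (\<lambda>(a, b). \<i> / 2 * muR_entry m k a b)" if "k \<in> verts Q" for k
      using that Fr_carrier[OF m that] by (intro eq_matI) (auto simp: mu_R_def muR_entry_def msum_def)
    moreover have "mu_R Q v m \<in> extensional (verts Q)" by (simp add: mu_R_def)
    ultimately show ?thesis
      by (auto simp: fun_eq_iff mat_eq_iff extensional_def restrict_def)
  qed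
  show ?thesis using C R by (auto simp: mu_zero_def)
qed

text \<open>Both moment maps are sums of the expressions in \<open>rotate_mat_mult_index\<close>
  over the arrow ends at \<open>k\<close> and the framing, so that identity adds up. Vanishing of
  all old entries therefore forces vanishing of the new ones.\<close>

lemma mu_entry_rep_rotate:
  assumes m: "m \<in> rep_space Q v w" and k: "k \<in> verts Q" and ab: "a < v k" "b < v k" and e: "e * e = 1"
  shows "muC_entry (rep_rotate Q e m) k a b =
      (muC_entry m k a b - cnj (muC_entry m k b a) - complex_of_real e * muR_entry m k a b) / 2"
    and "muR_entry (rep_rotate Q e m) k a b =
      complex_of_real e * (muC_entry m k a b + cnj (muC_entry m k b a))"
proof -
  have e': "- e * - e = 1" using e by simp
  have rot: "rep_rotate Q e m (ArrX h) = rotate_mat e (m (ArrX h)) (m (ArrY h))"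
    "rep_rotate Q e m (ArrY h) = rotate_mat (- e) (m (ArrY h)) (m (ArrX h))" if "h \<in> arcs Q" for h
    using that by (simp_all add: rep_rotate_def summands_def)
  have rotF: "rep_rotate Q e m (FrX k) = rotate_mat e (m (FrX k)) (m (FrY k))"
    "rep_rotate Q e m (FrY k) = rotate_mat (- e) (m (FrY k)) (m (FrX k))"
    using k by (simp_all add: rep_rotate_def summands_def)
  note F = rotate_mat_mult_index[OF Fr_carrier[OF m k] ab e]
  have H: "(rep_rotate Q e m (ArrX h) * rep_rotate Q e m (ArrY h)) $$ (a, b) =
      ((m (ArrX h) * m (ArrY h)) $$ (a, b) - cnj ((m (ArrX h) * m (ArrY h)) $$ (b, a))
        - complex_of_real e * (m (ArrX h) * mat_adjoint (m (ArrX h))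
            - mat_adjoint (m (ArrY h)) * m (ArrY h)) $$ (a, b)) / 2"
    "(rep_rotate Q e m (ArrX h) * mat_adjoint (rep_rotate Q e m (ArrX h))
        - mat_adjoint (rep_rotate Q e m (ArrY h)) * rep_rotate Q e m (ArrY h)) $$ (a, b) =
      complex_of_real e * ((m (ArrX h) * m (ArrY h)) $$ (a, b) + cnj ((m (ArrX h) * m (ArrY h)) $$ (b, a)))"
    if "h \<in> arcs Q" "head Q h = k" for h
    using rotate_mat_mult_index[OF Arr_carrier[OF m that(1)] _ _ e] that ab by (auto simp: rot)
  \<comment> \<open>At the outgoing end \<open>Y\<close> comes first, so the pair is rotated with
    \<open>- e\<close>. The reversed sign matches the minus sign of the commutator in
    \<open>muC_entry\<close>. A loop contributes at both ends.\<close>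
  have T: "(rep_rotate Q e m (ArrY h) * rep_rotate Q e m (ArrX h)) $$ (a, b) =
      ((m (ArrY h) * m (ArrX h)) $$ (a, b) - cnj ((m (ArrY h) * m (ArrX h)) $$ (b, a))
        + complex_of_real e * (m (ArrY h) * mat_adjoint (m (ArrY h))
            - mat_adjoint (m (ArrX h)) * m (ArrX h)) $$ (a, b)) / 2"
    "(rep_rotate Q e m (ArrY h) * mat_adjoint (rep_rotate Q e m (ArrY h))
        - mat_adjoint (rep_rotate Q e m (ArrX h)) * rep_rotate Q e m (ArrX h)) $$ (a, b) =
      - (complex_of_real e * ((m (ArrY h) * m (ArrX h)) $$ (a, b) + cnj ((m (ArrY h) * m (ArrX h)) $$ (b, a))))"
    if "h \<in> arcs Q" "tail Q h = k" for h
    using rotate_mat_mult_index[OF Arr_carrier(2,1)[OF m that(1)] _ _ e'] that ab by (auto simp: rot)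
  show "muC_entry (rep_rotate Q e m) k a b =
      (muC_entry m k a b - cnj (muC_entry m k b a) - complex_of_real e * muR_entry m k a b) / 2"
    unfolding muC_entry_def muR_entry_def rotF F(1)
    by (simp add: H T sum.distrib sum_subtractf sum_divide_distrib[symmetric] sum_distrib_left[symmetric]
        cong: sum.cong_simp) (simp add: field_simps)
  show "muR_entry (rep_rotate Q e m) k a b =
      complex_of_real e * (muC_entry m k a b + cnj (muC_entry m k b a))"
    unfolding muC_entry_def muR_entry_def rotF F(2)
    by (simp add: H T sum.distrib sum_negf sum_distrib_left[symmetric] cong: sum.cong_simp)
       (simp add: field_simps)
qed

lemma mu_zero_rep_space: "m \<in> mu_zero Q v w \<Longrightarrow> m \<in> rep_space Q v w"
  by (simp add: mu_zero_def)

lemma rep_rotate_mu_zero: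
  "m \<in> mu_zero Q v w \<Longrightarrow> e * e = 1 \<Longrightarrow> rep_rotate Q e m \<in> mu_zero Q v w"
  by (simp add: mu_zero_iff mu_entry_rep_rotate)

section \<open>The induced map on the quiver variety\<close>

lemma rep_conj_carrier [simp]: "m \<in> rep_space Q v w \<Longrightarrow> rep_conj Q m \<in> rep_space Q v w"
  by (auto simp: rep_conj_def rep_space_def PiE_iff)

lemma cx_I_carrier [simp]: "m \<in> rep_space Q v w \<Longrightarrow> cx_I Q m \<in> rep_space Q v w"
  by (auto simp: cx_I_def rep_space_def PiE_iff)

lemma cx_J_apply:
  assumes "m \<in> rep_space Q v w" "s \<in> summands Q"
  shows "cx_J Q m s = complex_of_real (- dual_sign s) \<cdot>\<^sub>m mat_adjoint (m (dual s))"
  using assms(2) by (cases s) (auto simp: cx_J_def intro!: eq_matI)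

lemma cx_K_carrier [simp]:
  assumes m: "m \<in> rep_space Q v w" shows "cx_K Q m \<in> rep_space Q v w"
proof -
  have "cx_J Q m s \<in> carrier_mat (cod_dim Q v w s) (dom_dim Q v w s)" if s: "s \<in> summands Q" for s
    using rep_space_carrier_dual[OF m s] by (simp add: cx_J_apply[OF m s])
  then show ?thesis by (auto simp: cx_K_def cx_I_def rep_space_def PiE_iff)
qed

text \<open>This is \<open>q i = k q\<close> for \<open>q = (1 - j) / \<surd>2\<close>, which commutes with the split conjugation.\<close>

lemma rep_rotate_cx_I_conj:
  assumes m: "m \<in> rep_space Q v w"
  shows "rep_rotate Q 1 (cx_I Q (rep_conj Q m)) = cx_K Q (rep_conj Q (rep_rotate Q 1 m))"
proof (rule rep_eqI)
  fix s assume s: "s \<in> summands Q"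
  note c = rep_space_carrier[OF m s] rep_space_carrier_dual[OF m s]
  have r: "rep_conj Q (rep_rotate Q 1 m) \<in> rep_space Q v w" using m by simp
  have cl: "rep_rotate Q 1 (cx_I Q (rep_conj Q m)) s \<in> carrier_mat (cod_dim Q v w s) (dom_dim Q v w s)"
    by (intro rep_space_carrier s rep_rotate_rep_space cx_I_carrier rep_conj_carrier m)
  have cr: "cx_K Q (rep_conj Q (rep_rotate Q 1 m)) s \<in> carrier_mat (cod_dim Q v w s) (dom_dim Q v w s)"
    by (intro rep_space_carrier s cx_K_carrier r)
  show "rep_rotate Q 1 (cx_I Q (rep_conj Q m)) s = cx_K Q (rep_conj Q (rep_rotate Q 1 m)) s"
  proof (rule eq_matI)
    have K: "cx_K Q (rep_conj Q (rep_rotate Q 1 m)) s = \<i> \<cdot>\<^sub>m (complex_of_real (- dual_sign s) \<cdot>\<^sub>m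
        mat_adjoint (rep_conj Q (rep_rotate Q 1 m) (dual s)))"
      using s by (simp add: cx_K_def cx_I_def cx_J_apply[OF r s])
    have sgn: "complex_of_real (dual_sign s) * (complex_of_real (dual_sign s) * z) = z" for z
      by (cases s) auto
    fix i j assume "i < dim_row (cx_K Q (rep_conj Q (rep_rotate Q 1 m)) s)"
      "j < dim_col (cx_K Q (rep_conj Q (rep_rotate Q 1 m)) s)"
    then have ij: "i < cod_dim Q v w s" "j < dom_dim Q v w s"
      by (simp_all only: carrier_matD[OF cr])
    \<comment> \<open>Inside the adjoint the two conjugations of the dual entry cancel, while
      \<open>\<i>\<close> becomes its negative; this is the relation IJ = -JI in entries.\<close>
    have "rep_rotate Q 1 (cx_I Q (rep_conj Q m)) s $$ (i, j) =
        half_root * (\<i> * cnj (m s $$ (i, j)) - \<i> * (dual_sign s * m (dual s) $$ (j, i)))"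
      using c s ij by (simp add: rep_rotate_apply cx_I_def rep_conj_def rotate_mat_def)
    also have "\<dots> = cx_K Q (rep_conj Q (rep_rotate Q 1 m)) s $$ (i, j)"
      unfolding K using c s ij by (simp add: rep_conj_def rep_rotate_apply rotate_mat_def algebra_simps sgn)
    finally show "rep_rotate Q 1 (cx_I Q (rep_conj Q m)) s $$ (i, j) =
      cx_K Q (rep_conj Q (rep_rotate Q 1 m)) s $$ (i, j)" .
  qed (simp_all only: carrier_matD[OF cl] carrier_matD[OF cr])
qed (use m in simp_all)

section \<open>Real scalars and real coordinates\<close>

lemma rep_scale_carrier [simp]: "m \<in> rep_space Q v w \<Longrightarrow> rep_scale Q t m \<in> rep_space Q v w"
  by (auto simp: rep_scale_def rep_space_def PiE_iff)

lemma rep_rotate_scale: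
  assumes m: "m \<in> rep_space Q v w"
  shows "rep_rotate Q e (rep_scale Q t m) = rep_scale Q t (rep_rotate Q e m)"
proof (rule rep_eqI)
  show "rep_rotate Q e (rep_scale Q t m) \<in> rep_space Q v w"
    "rep_scale Q t (rep_rotate Q e m) \<in> rep_space Q v w"
    using m by simp_all
  fix s assume s: "s \<in> summands Q"
  show "rep_rotate Q e (rep_scale Q t m) s = rep_scale Q t (rep_rotate Q e m) s"
    using rep_space_carrier[OF m s] rep_space_carrier_dual[OF m s] s
    by (intro eq_matI) (auto simp: rep_rotate_apply rep_scale_def rotate_mat_def algebra_simps)
qed

text \<open>The matrix of the rotation in real coordinates. The adjoint transposes the indices and
  negates imaginary parts, which are the coordinates with \<open>b\<close> false.\<close>

definition rot_coeff where
  "rot_coeff e p q = (case p of (s, i, j, b) \<Rightarrow>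
     ((if q = p then 1 else 0) +
      e * dual_sign s * (if b then 1 else - 1) * (if q = (dual s, j, i, b) then 1 else 0)) / sqrt 2)"

lemma finite_coord_set: "finite (coord_set Q v w)"
  unfolding coord_set_def by (intro finite_SigmaI finite_summands finite_cartesian_product) auto

lemma coords_rep_rotate:
  assumes m: "m \<in> rep_space Q v w"
  shows "coords Q v w (rep_rotate Q e m) =
    linear_subst (coord_set Q v w) (coord_set Q v w) (rot_coeff e) (coords Q v w m)"
proof
  fix p
  show "coords Q v w (rep_rotate Q e m) p =
    linear_subst (coord_set Q v w) (coord_set Q v w) (rot_coeff e) (coords Q v w m) p"
  proof (cases "p \<in> coord_set Q v w")
    case True
    obtain s i j b where p: "p = (s, i, j, b)" by (cases p)
    have s: "s \<in> summands Q" and ij: "i < cod_dim Q v w s" "j < dom_dim Q v w s"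
      using True by (auto simp: p coord_set_def)
    have p': "(dual s, j, i, b) \<in> coord_set Q v w"
      using s ij by (auto simp: coord_set_def)
    define \<kappa> where "\<kappa> = e * dual_sign s * (if b then 1 else - 1)"
    \<comment> \<open>Splitting row \<open>p\<close> into its two indicator terms lets the sum over
      all coordinates be evaluated at \<open>p\<close> and at its dual position.\<close>
    have coeff: "rot_coeff e p q * x = (if q = p then x else 0) / sqrt 2 +
        (if q = (dual s, j, i, b) then \<kappa> * x else 0) / sqrt 2" for q x
    proof -
      have "rot_coeff e p q = ((if q = p then 1 else 0) + \<kappa> * (if q = (dual s, j, i, b) then 1 else 0)) / sqrt 2"
        by (simp only: rot_coeff_def p \<kappa>_def prod.case)
      then show ?thesis by (simp add: add_divide_distrib distrib_right)
    qed
    have "linear_subst (coord_set Q v w) (coord_set Q v w) (rot_coeff e) (coords Q v w m) p =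
        (coords Q v w m p + \<kappa> * coords Q v w m (dual s, j, i, b)) / sqrt 2"
      using True p' finite_coord_set
      by (simp only: linear_subst_def restrict_apply if_True coeff sum.distrib
          sum_divide_distrib[symmetric] sum.delta add_divide_distrib)
    also have "\<dots> = coords Q v w (rep_rotate Q e m) p"
      using True p' s
      by (cases b) (simp_all add: coords_def p rep_rotate_apply half_root_def \<kappa>_def
          index_rotate_mat[OF rep_space_carrier[OF m s] rep_space_carrier_dual[OF m s] ij])
    finally show ?thesis by simp
  qed (simp add: coords_def linear_subst_def)
qed

section \<open>Topology of the quotient\<close>

lemma topspace_rep_top: "topspace (rep_top Q v w) = rep_space Q v w"
  by (auto simp: rep_top_def topspace_pullback_topology coords_def)

lemma continuous_map_linear_subst:
  assumes "finite J"
  shows "continuous_map (product_topology (\<lambda>_. euclideanreal) J) (product_topology (\<lambda>_. euclideanreal) I)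
    (linear_subst I J l)"
  unfolding continuous_map_componentwise
proof (intro conjI ballI)
  show "linear_subst I J l ` topspace (product_topology (\<lambda>_. euclideanreal) J) \<subseteq> extensional I"
    by (auto simp: linear_subst_def)
  fix i assume "i \<in> I"
  then show "continuous_map (product_topology (\<lambda>_. euclideanreal) J) euclideanreal
      (\<lambda>x. linear_subst I J l x i)"
    using assms unfolding linear_subst_def
    by (auto intro!: continuous_intros continuous_map_product_projection)
qed

text \<open>The topology is pulled back along \<open>coords\<close>, so continuity may be tested in
  coordinates, where the rotation is linear.\<close>

lemma continuous_map_rep_rotate:
  "continuous_map (rep_top Q v w) (rep_top Q v w) (rep_rotate Q e)"
  unfolding rep_top_def
proof (rule continuous_map_pullback')
  let ?P = "product_topology (\<lambda>_. euclideanreal) (coord_set Q v w)"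
  let ?T = "pullback_topology (rep_space Q v w) (coords Q v w) ?P"
  have "continuous_map ?T ?P
      (linear_subst (coord_set Q v w) (coord_set Q v w) (rot_coeff e) \<circ> coords Q v w)"
    by (intro continuous_map_pullback continuous_map_linear_subst finite_coord_set)
  then show "continuous_map ?T ?P (coords Q v w \<circ> rep_rotate Q e)"
    by (rule continuous_map_eq) (simp add: topspace_pullback_topology coords_rep_rotate)
  show "topspace ?T \<subseteq> rep_rotate Q e -` rep_space Q v w"
    by (auto simp: topspace_pullback_topology)
qed

lemma topspace_mu_zero: "topspace (subtopology (rep_top Q v w) (mu_zero Q v w)) = mu_zero Q v w"
  using mu_zero_rep_space by (auto simp: topspace_rep_top)

lemma topspace_M0_top: "topspace (M0_top Q v w) = M0 Q v w"
proof -
  have "{m \<in> mu_zero Q v w. V_orbit Q v w m \<in> M0 Q v w} = mu_zero Q v w"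
    by (auto simp: M0_def)
  then have "openin (M0_top Q v w) (M0 Q v w)"
    unfolding openin_M0_top
    using openin_topspace[of "subtopology (rep_top Q v w) (mu_zero Q v w)", unfolded topspace_mu_zero]
    by simp
  then have "M0 Q v w \<subseteq> topspace (M0_top Q v w)" by (rule openin_subset)
  moreover have "topspace (M0_top Q v w) \<subseteq> M0 Q v w"
    by (rule openin_topspace[of "M0_top Q v w", unfolded openin_M0_top, THEN conjunct1])
  ultimately show ?thesis by simp
qed

lemma M0_subset: "p \<in> M0 Q v w \<Longrightarrow> p \<subseteq> rep_space Q v w"
  unfolding M0_def using V_orbit_subset mu_zero_rep_space by blast

lemma induced_rotate_orbit:
  "m \<in> mu_zero Q v w \<Longrightarrow> induced (rep_rotate Q e) (V_orbit Q v w m) = V_orbit Q v w (rep_rotate Q e m)"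
  by (simp add: induced_def V_orbit_rep_rotate mu_zero_rep_space)

lemma induced_rotate_M0:
  "p \<in> M0 Q v w \<Longrightarrow> e * e = 1 \<Longrightarrow> induced (rep_rotate Q e) p \<in> M0 Q v w"
  by (auto simp: M0_def induced_rotate_orbit rep_rotate_mu_zero)

lemma induced_rotate_inverse:
  assumes "p \<subseteq> rep_space Q v w" "e * e = 1"
  shows "induced (rep_rotate Q (- e)) (induced (rep_rotate Q e) p) = p"
proof -
  have "(\<lambda>m. rep_rotate Q (- e) (rep_rotate Q e m)) ` p = (\<lambda>m. m) ` p"
    by (rule image_cong) (use assms in \<open>auto intro: rep_rotate_inverse\<close>)
  then show ?thesis by (simp add: induced_def image_image)
qed

text \<open>Openness in the quotient is openness of the saturated preimage in
  \<open>mu_zero\<close>. The rotation preserves \<open>mu_zero\<close> and carries orbits onto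
  orbits, so taking preimages upstairs and downstairs agrees.\<close>

lemma continuous_map_induced_rotate:
  assumes e: "e * e = 1"
  shows "continuous_map (M0_top Q v w) (M0_top Q v w) (induced (rep_rotate Q e))"
  unfolding continuous_map_def topspace_M0_top
proof (intro conjI allI impI)
  show "induced (rep_rotate Q e) \<in> M0 Q v w \<rightarrow> M0 Q v w"
    using e by (simp add: induced_rotate_M0)
  fix U assume U: "openin (M0_top Q v w) U"
  let ?Z = "subtopology (rep_top Q v w) (mu_zero Q v w)"
  have "continuous_map ?Z ?Z (rep_rotate Q e)"
    using continuous_map_rep_rotate e
    by (auto simp: continuous_map_in_subtopology topspace_mu_zero rep_rotate_mu_zero
        intro: continuous_map_from_subtopology)
  then have "openin ?Z {m \<in> topspace ?Z. rep_rotate Q e m \<in> {m \<in> mu_zero Q v w. V_orbit Q v w m \<in> U}}"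
    using U openin_continuous_map_preimage unfolding openin_M0_top by blast
  also have "{m \<in> topspace ?Z. rep_rotate Q e m \<in> {m \<in> mu_zero Q v w. V_orbit Q v w m \<in> U}} =
      {m \<in> mu_zero Q v w. V_orbit Q v w m \<in> {p \<in> M0 Q v w. induced (rep_rotate Q e) p \<in> U}}"
    unfolding topspace_mu_zero using e by (auto simp: rep_rotate_mu_zero induced_rotate_orbit M0_def)
  finally show "openin (M0_top Q v w) {p \<in> M0 Q v w. induced (rep_rotate Q e) p \<in> U}"
    unfolding openin_M0_top by blast
qed

lemma homeomorphic_maps_induced_rotate:
  "homeomorphic_maps (M0_top Q v w) (M0_top Q v w) (induced (rep_rotate Q 1)) (induced (rep_rotate Q (- 1)))"
  unfolding homeomorphic_maps_def topspace_M0_top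
  using induced_rotate_inverse[OF M0_subset, of _ 1] induced_rotate_inverse[OF M0_subset, of _ "- 1"]
  by (simp add: continuous_map_induced_rotate)

section \<open>Strata, fixed points and analyticity\<close>

lemma induced_rotate_stratum:
  assumes "e * e = 1" "p \<in> stratum Q v w L"
  shows "induced (rep_rotate Q e) p \<in> stratum Q v w L"
proof -
  obtain m where m: "m \<in> mu_zero Q v w" "conjugate_in (U_group Q v) (V_stab Q v w m) L"
    and p: "p = V_orbit Q v w m"
    using assms(2) by (auto simp: stratum_def)
  then have "V_stab Q v w (rep_rotate Q e m) = V_stab Q v w m"
    using assms(1) mu_zero_rep_space V_stab_rep_rotate by blast
  then show ?thesis
    using m assms(1) unfolding p stratum_def
    by (auto simp: induced_rotate_orbit rep_rotate_mu_zero)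
qed

lemma induced_rotate_stratum_iff:
  assumes "p \<in> M0 Q v w"
  shows "induced (rep_rotate Q 1) p \<in> stratum Q v w L \<longleftrightarrow> p \<in> stratum Q v w L"
  using induced_rotate_stratum[of 1 p L] induced_rotate_stratum[of "- 1" "induced (rep_rotate Q 1) p" L]
    induced_rotate_inverse[OF M0_subset[OF assms], of 1] by auto

lemma alpha1_induced_rotate:
  assumes "p \<subseteq> rep_space Q v w"
  shows "alpha1 Q (induced (rep_rotate Q 1) p) = induced (rep_rotate Q 1) (alpha0 Q p)"
  unfolding alpha0_def alpha1_def induced_def o_def image_image
  by (rule image_cong) (use assms in \<open>auto simp: rep_rotate_cx_I_conj\<close>)

text \<open>The rotation intertwines \<open>alpha0\<close> with \<open>alpha1\<close>, and its
  injectivity allows the fixed point equation to be pulled back.\<close>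

lemma induced_rotate_real_iff:
  assumes p: "p \<in> M0 Q v w"
  shows "induced (rep_rotate Q 1) p \<in> M0_sym Q v w \<longleftrightarrow> p \<in> M0_real Q v w"
proof -
  \<comment> \<open>Cancellation takes place among subsets of the representation space, so this
    inclusion is what injectivity of taking images asks for.\<close>
  have "alpha0 Q p \<subseteq> rep_space Q v w"
    using M0_subset[OF p] by (auto simp: alpha0_def induced_def)
  then have "induced (rep_rotate Q 1) (alpha0 Q p) = induced (rep_rotate Q 1) p \<longleftrightarrow> alpha0 Q p = p"
    unfolding induced_def by (intro inj_on_image_eq_iff[OF inj_on_rep_rotate]) (use M0_subset[OF p] in auto)
  then show ?thesis
    using p by (simp add: M0_real_def M0_sym_def alpha1_induced_rotate[OF M0_subset[OF p]] induced_rotate_M0)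
qed

text \<open>A local analytic extension \<open>F\<close> of a function on the target, composed with
  the linear coordinate map, is a local analytic extension of the pulled-back function.\<close>

lemma M0_analytic_map_induced_rotate:
  assumes e: "e * e = 1" and S: "S \<subseteq> M0 Q v w" and T: "T \<subseteq> M0 Q v w"
    and ST: "induced (rep_rotate Q e) ` S \<subseteq> T"
  shows "M0_analytic_map Q v w S T (induced (rep_rotate Q e))"
  unfolding M0_analytic_map_def
proof (intro conjI allI impI)
  let ?f = "induced (rep_rotate Q e)" and ?C = "coord_set Q v w" and ?l = "rot_coeff e"
  show "continuous_map (subtopology (M0_top Q v w) S) (subtopology (M0_top Q v w) T) ?f"
    using continuous_map_induced_rotate[OF e] ST
    by (auto simp: continuous_map_in_subtopology intro: continuous_map_from_subtopology)
  fix U u assume "openin (subtopology (M0_top Q v w) T) U \<and> M0_analytic_fun Q v w U u"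
  then have u: "M0_analytic_fun Q v w U u" ..
  show "M0_analytic_fun Q v w (S \<inter> ?f -` U) (u \<circ> ?f)"
    unfolding M0_analytic_fun_def
  proof (intro ballI)
    fix p m assume p: "p \<in> S \<inter> ?f -` U" and m: "m \<in> p"
    have rep: "m' \<in> rep_space Q v w" if "p' \<in> S" "m' \<in> p'" for p' m'
      using that S M0_subset by blast
    have "?f p \<in> U" "rep_rotate Q e m \<in> ?f p" using p m by (auto simp: induced_def)
    from u[unfolded M0_analytic_fun_def, THEN bspec, THEN bspec, OF this] obtain F r where r: "r > 0"
      and F: "real_analytic_at ?C F (coords Q v w (rep_rotate Q e m))"
      and uF: "\<forall>p'\<in>U. \<forall>m'\<in>p'. (\<forall>i\<in>?C. \<bar>coords Q v w m' i - coords Q v w (rep_rotate Q e m) i\<bar> < r) \<longrightarrow>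
           u p' = F (coords Q v w m')"
      by (elim exE conjE)
    \<comment> \<open>With this radius, points near \<open>m\<close> rotate into the cube of radius
      \<open>r\<close> where \<open>F\<close> represents \<open>u\<close>.\<close>
    obtain \<delta> where \<delta>: "\<delta> > 0"
      "\<forall>d. (\<forall>j\<in>?C. \<bar>d j\<bar> < \<delta>) \<longrightarrow> (\<forall>i\<in>?C. (\<Sum>j\<in>?C. \<bar>?l i j\<bar> * \<bar>d j\<bar>) < r)"
      using linear_subst_small[OF finite_coord_set finite_coord_set r, of ?l] by blast
    have m_rep: "m \<in> rep_space Q v w" using p m rep by blast
    show "\<exists>F r. r > 0 \<and> real_analytic_at ?C F (coords Q v w m) \<and>
        (\<forall>p'\<in>S \<inter> ?f -` U. \<forall>m'\<in>p'. (\<forall>i\<in>?C. \<bar>coords Q v w m' i - coords Q v w m i\<bar> < r) \<longrightarrow>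
           (u \<circ> ?f) p' = F (coords Q v w m'))"
    proof (intro exI conjI ballI impI)
      show "real_analytic_at ?C (F \<circ> linear_subst ?C ?C ?l) (coords Q v w m)"
        by (rule real_analytic_at_linear_subst[OF finite_coord_set finite_coord_set])
          (use F in \<open>simp add: coords_rep_rotate[OF m_rep]\<close>)
      fix p' m' assume p': "p' \<in> S \<inter> ?f -` U" "m' \<in> p'"
        and near: "\<forall>i\<in>?C. \<bar>coords Q v w m' i - coords Q v w m i\<bar> < \<delta>"
      have m'_rep: "m' \<in> rep_space Q v w" using p' rep by blast
      have "\<bar>coords Q v w (rep_rotate Q e m') i - coords Q v w (rep_rotate Q e m) i\<bar> < r"
        if i: "i \<in> ?C" for i
      proof -
        have "(\<Sum>j\<in>?C. \<bar>?l i j\<bar> * \<bar>coords Q v w m' j - coords Q v w m j\<bar>) < r"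
          by (rule \<delta>(2)[THEN spec[of _ "\<lambda>j. coords Q v w m' j - coords Q v w m j"], THEN mp,
                THEN bspec, OF near i])
        then show ?thesis
          unfolding coords_rep_rotate[OF m_rep] coords_rep_rotate[OF m'_rep]
          by (rule le_less_trans[OF linear_subst_diff_le[OF i]])
      qed
      moreover have "?f p' \<in> U" "rep_rotate Q e m' \<in> ?f p'" using p' by (auto simp: induced_def)
      ultimately have "u (?f p') = F (coords Q v w (rep_rotate Q e m'))" using uF by blast
      then show "(u \<circ> ?f) p' = (F \<circ> linear_subst ?C ?C ?l) (coords Q v w m')"
        by (simp add: coords_rep_rotate[OF m'_rep])
    qed (rule \<delta>(1))
  qed
qed

section \<open>Equivariance on the quotient\<close>

lemma induced_rotate_W_act:
  assumes p: "p \<subseteq> rep_space Q v w" and g: "g \<in> O_real Q w"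
  shows "induced (rep_rotate Q e) (W_act Q v w g p) = W_act Q v w g (induced (rep_rotate Q e) p)"
proof -
  have "g \<in> carrier (U_group Q w)" using g by (simp add: O_real_def)
  then show ?thesis
    unfolding W_act_def induced_def image_image
    by (intro image_cong refl rep_rotate_rep_act one_in_U_group) (use p in auto)
qed

lemma induced_rotate_M0_scale:
  "p \<subseteq> rep_space Q v w \<Longrightarrow>
    induced (rep_rotate Q e) (M0_scale Q t p) = M0_scale Q t (induced (rep_rotate Q e) p)"
  unfolding M0_scale_def induced_def image_image
  by (intro image_cong refl rep_rotate_scale) auto

lemma W_act_subset:
  assumes "p \<subseteq> rep_space Q v w" "g \<in> O_real Q w"
  shows "W_act Q v w g p \<subseteq> rep_space Q v w"
  using assms by (auto simp: W_act_def induced_def O_real_def intro!: rep_act_rep_space one_in_U_group)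

end

section \<open>Transfer to fixed points, strata and leaves\<close>

theorem theorem3p2:
  fixes Q :: "('k, 'h) pre_digraph" and v w :: "'k \<Rightarrow> nat"
  assumes "fin_digraph Q"
  shows "\<exists>f.
      homeomorphic_map (subtopology (M0_top Q v w) (M0_real Q v w))
                       (subtopology (M0_top Q v w) (M0_sym Q v w)) f \<and>
      (\<forall>L. subgroup L (U_group Q v) \<longrightarrow>
         f ` (stratum Q v w L \<inter> M0_real Q v w) = stratum Q v w L \<inter> M0_sym Q v w) \<and>
      (\<forall>g\<in>O_real Q w. \<forall>t. t \<noteq> 0 \<longrightarrow> (\<forall>p\<in>M0_real Q v w.
         f (M0_scale Q t (W_act Q v w g p)) = M0_scale Q t (W_act Q v w g (f p)))) \<and>
      (\<forall>A\<in>real_leaves Q v w.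
         f ` A \<in> sym_leaves Q v w \<and>
         M0_analytic_iso Q v w A (f ` A) f \<and>
         (\<forall>g\<in>O_real Q w. \<forall>p\<in>A. f (W_act Q v w g p) = W_act Q v w g (f p))) \<and>
      bij_betw (\<lambda>A. f ` A) (real_leaves Q v w) (sym_leaves Q v w) \<and>
      (\<forall>A\<in>real_leaves Q v w. \<forall>B\<in>real_leaves Q v w.
         A \<subseteq> M0_top Q v w closure_of B \<longleftrightarrow> f ` A \<subseteq> M0_top Q v w closure_of (f ` B))"
proof -
  interpret quiver Q v w by (intro quiver.intro assms)
  let ?f = "induced (rep_rotate Q 1)" and ?g = "induced (rep_rotate Q (- 1))"
  let ?T = "M0_top Q v w" and ?R = "M0_real Q v w" and ?S = "M0_sym Q v w" and ?M = "M0 Q v w"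
  have f_M: "?f p \<in> ?M" if "p \<in> ?M" for p using induced_rotate_M0[OF that, of 1] by simp
  have gf: "?g (?f p) = p" if "p \<in> ?M" for p
    using induced_rotate_inverse[OF M0_subset[OF that], of 1] by simp
  have fg: "?f (?g p) = p" if "p \<in> ?M" for p
    using induced_rotate_inverse[OF M0_subset[OF that], of "- 1"] by simp
  have RM: "?R \<subseteq> ?M" and SM: "?S \<subseteq> ?M" by (auto simp: M0_real_def M0_sym_def)
  have hom: "homeomorphic_map ?T ?T ?f"
    using homeomorphic_maps_induced_rotate homeomorphic_map_maps by blast
  have inj: "inj_on ?f ?M" by (rule inj_on_inverseI[where g = ?g]) (rule gf)
  \<comment> \<open>Restricting a homeomorphism to subspaces takes an equivalence of memberships;
    the backward direction supplies surjectivity.\<close>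
  have hom_real: "homeomorphic_map (subtopology ?T ?R) (subtopology ?T ?S) ?f"
    by (rule homeomorphic_map_subtopologies_alt[OF hom]) (simp add: topspace_M0_top induced_rotate_real_iff)
  have hom_stratum: "homeomorphic_map (subtopology ?T (stratum Q v w L \<inter> ?R))
      (subtopology ?T (stratum Q v w L \<inter> ?S)) ?f" for L
    by (rule homeomorphic_map_subtopologies_alt[OF hom])
      (simp add: topspace_M0_top induced_rotate_real_iff induced_rotate_stratum_iff)
  have f_stratum: "?f ` (stratum Q v w L \<inter> ?R) = stratum Q v w L \<inter> ?S" for L
    using homeomorphic_imp_surjective_map[OF hom_stratum[of L]] RM SM
    by (simp add: topspace_M0_top Int_absorb1 le_infI2)
  \<comment> \<open>Homeomorphisms carry components onto components. Since every stratum is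
    preserved with the same \<open>L\<close>, the two unions agree index by index.\<close>
  have leaves: "sym_leaves Q v w = (`) ?f ` real_leaves Q v w"
    unfolding sym_leaves_def real_leaves_def
    by (simp add: homeomorphic_map_connected_components_of[OF hom_stratum] image_UN)
  have leaf_real: "A \<subseteq> ?R" if "A \<in> real_leaves Q v w" for A
    using that connected_components_of_subset unfolding real_leaves_def by fastforce
  then have leaf: "A \<subseteq> ?M" if "A \<in> real_leaves Q v w" for A
    using that RM by blast
  have "?f (M0_scale Q t (W_act Q v w g p)) = M0_scale Q t (W_act Q v w g (?f p))"
    if "g \<in> O_real Q w" "p \<in> ?R" for g t p
    using that RM M0_subset[of p]
    by (simp add: subset_iff induced_rotate_M0_scale[OF W_act_subset] induced_rotate_W_act)
  moreover have "M0_analytic_iso Q v w A (?f ` A) ?f" if "A \<in> real_leaves Q v w" for A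
    unfolding M0_analytic_iso_def
  proof (intro exI[of _ ?g] conjI ballI)
    have A: "A \<subseteq> ?M" "?f ` A \<subseteq> ?M" using leaf[OF that] f_M by auto
    show "M0_analytic_map Q v w A (?f ` A) ?f"
      by (rule M0_analytic_map_induced_rotate) (use A in auto)
    show "M0_analytic_map Q v w (?f ` A) A ?g"
      by (rule M0_analytic_map_induced_rotate) (use A gf in auto)
    show "?g (?f p) = p" if "p \<in> A" for p using that A gf by auto
    show "?f (?g q) = q" if "q \<in> ?f ` A" for q using that A fg by auto
  qed
  moreover have "?f (W_act Q v w g p) = W_act Q v w g (?f p)"
    if "A \<in> real_leaves Q v w" "g \<in> O_real Q w" "p \<in> A" for A g p
    using that leaf M0_subset by (intro induced_rotate_W_act) blast+
  \<comment> \<open>Surjectivity is \<open>leaves\<close>; injectivity on leaves comes from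
    injectivity of \<open>?f\<close> on \<open>?M\<close>, which contains them all.\<close>
  moreover have "bij_betw ((`) ?f) (real_leaves Q v w) (sym_leaves Q v w)"
    unfolding bij_betw_def leaves
    using inj_on_subset[OF inj_on_image_Pow[OF inj]] leaf by blast
  moreover have "A \<subseteq> ?T closure_of B \<longleftrightarrow> ?f ` A \<subseteq> ?T closure_of (?f ` B)"
    if "A \<in> real_leaves Q v w" "B \<in> real_leaves Q v w" for A B
  proof -
    \<comment> \<open>Closures are taken in the whole quiver variety, hence the appeal to
      \<open>hom\<close>, the homeomorphism of all of \<open>?T\<close>, rather than to its
      restrictions.\<close>
    have "?T closure_of (?f ` B) = ?f ` (?T closure_of B)"
      using homeomorphic_map_closure_of[OF hom] leaf[OF that(2)] by (simp add: topspace_M0_top)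
    then show ?thesis
      using inj_on_image_subset_iff[OF inj leaf[OF that(1)]] closure_of_subset_topspace[of ?T B]
      by (simp add: topspace_M0_top)
  qed
  ultimately show ?thesis
    using hom_real f_stratum leaves by (intro exI[of _ ?f]) simp
qed

end
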